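(* Let $\alpha$ be a fixed positive non-integer rational number. Then for every aperiodic dynamical system $(X,\Sigma,\mu,T^t)$ and every $\epsilon>0$, there exists a set $E\in\Sigma$ such that $\mu(E)<\epsilon$, $$\limsup_{N\to\infty}\frac1N\sum_{n=1}^{N}\mathbf 1_E(T^{n^\alpha}x)=1\quad\text{for } \mu\text{-a.e. }x\in X,$$ and $$\liminf_{N\to\infty}\frac1N\sum_{n=1}^{N}\mathbf 1_E(T^{n^\alpha}x)=0\quad\text{for } \mu\text{-a.e. }x\in X.$$
   Context: A Lebesgue probability space $(X,\Sigma,\mu)$ is a complete, countably additive probability space that is measure-theoretically isomorphic to a measurable subset of the unit interval with Lebesgue measure. A flow $\{T^t:t\in\mathbb R\}$ is a group of measurable transformations $T^t:X\to X$ with $T^0(x)=x$ and $T^{t+s}=T^t\circ T^s$ for $s,t\in\mathbb R$. It is measurable if $(x,t)\mapsto T^t(x)$ from $X\times\mathbb R$ to $X$ is measurable with respect to the completion of the product of $\mu$ and Lebesgue measure on $\mathbb R$. It is measure preserving if it is measurable and $\mu((T^t)^{-1}A)=\mu(A)$ for all $A\in\Sigma$ and $t\in\mathbb R$. A dynamical system is a quadruple $(X,\Sigma,\mu,T^t)$ consisting of a Lebesgue probability space and a measure preserving flow on it. It is aperiodic if $\mu\{x: T^t(x)=T^s(x)\text{ for some }t\neq s\}=0$. $\mathbf 1_E$ is the indicator function of $E$. *)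

theory Defs
  imports "HOL-Probability.Probability"
begin

(* Isomorphism modulo null sets: X and Y are the conull sets on which f is a bijection. *)
definition measure_isomorphic :: "'a measure \<Rightarrow> 'b measure \<Rightarrow> bool" where
  "measure_isomorphic M N \<longleftrightarrow>
    (\<exists>X\<in>sets M. \<exists>Y\<in>sets N. \<exists>f g.
       space M - X \<in> null_sets M \<and> space N - Y \<in> null_sets N \<and>
       f \<in> restrict_space M X \<rightarrow>\<^sub>M restrict_space N Y \<and>
       g \<in> restrict_space N Y \<rightarrow>\<^sub>M restrict_space M X \<and>
       (\<forall>x\<in>X. g (f x) = x) \<and> (\<forall>y\<in>Y. f (g y) = y) \<and>
       distr (restrict_space M X) (restrict_space N Y) f = restrict_space N Y)"

locale lebesgue_prob_space = prob_space M + complete_measure M for M :: "'a measure" +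
  assumes isomorphic_unit_interval:
    "\<exists>B\<in>sets (lebesgue :: real measure). B \<subseteq> {0..1} \<and> measure_isomorphic M (restrict_space lebesgue B)"

locale flow =
  fixes M :: "'a measure" and T :: "real \<Rightarrow> 'a \<Rightarrow> 'a"
  assumes measurable_time: "T t \<in> M \<rightarrow>\<^sub>M M"
    and zero_time: "x \<in> space M \<Longrightarrow> T 0 x = x"
    and add_time: "x \<in> space M \<Longrightarrow> T (t + s) x = T t (T s x)"

locale measurable_flow = flow +
  assumes jointly_measurable:
    "(\<lambda>(x, t). T t x) \<in> completion (M \<Otimes>\<^sub>M (lebesgue :: real measure)) \<rightarrow>\<^sub>M M"

locale measure_preserving_flow = measurable_flow +
  assumes measure_preserving: "A \<in> sets M \<Longrightarrow> emeasure M (T t -` A \<inter> space M) = emeasure M A"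

locale dynamical_system = lebesgue_prob_space M + measure_preserving_flow M T
  for M :: "'a measure" and T :: "real \<Rightarrow> 'a \<Rightarrow> 'a"

(* null_sets includes measurability; emeasure would return the value 0 on a non-measurable set. *)
locale aperiodic_dynamical_system = dynamical_system +
  assumes aperiodic: "{x \<in> space M. \<exists>t s. t \<noteq> s \<and> T t x = T s x} \<in> null_sets M"

end

theory Submission
  imports Defs
    "HOL-Computational_Algebra.Computational_Algebra"
    "HOL-Computational_Algebra.Field_as_Ring"
    "HOL-Combinatorics.Permutations"
begin

text \<open>
  Write \<open>\<alpha> = a / b\<close> in lowest terms.  The integers \<open>s^b * m\<close> with \<open>m\<close> free of \<open>b\<close>-th powers form the
  \<open>s\<close>-th stratum.  The first \<open>S\<close> strata miss a set of density at most \<open>1 / S\<close>, and on each stratum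
  the numbers \<open>n powr \<alpha>\<close> are linearly independent over the rationals, so an additive function on
  the reals can take prescribed values at them.

  The finitely many times involved at one stage generate an amenable group, so there is a measurable
  function \<open>\<phi>\<close> with \<open>\<phi> (T t x) = \<phi> x + t\<close> for all these times \<open>t\<close> outside a small set.  Composing \<open>\<phi>\<close>
  with one additive function per stratum colours \<open>X\<close> by \<open>[K]^S\<close> in such a way that a time from the
  \<open>s\<close>-th stratum shifts the \<open>s\<close>-th colour by a prescribed amount.  Reserving one long block of integers
  for every shift vector, every orbit meets, during a suitable block, the set of points with
  some coordinate equal to a fixed colour; this set has measure at most \<open>S / K\<close>.  Infinitely many
  such sets, alternately added and removed, give the final set.
\<close>

section \<open>Linear independence of radicals\<close>

abbreviation rat_scale :: "rat \<Rightarrow> real \<Rightarrow> real" where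
  "rat_scale q x \<equiv> of_rat q * x"

interpretation rat_real: vector_space rat_scale
  by standard (simp_all add: algebra_simps of_rat_add of_rat_mult)

interpretation rat_real_pair: vector_space_pair rat_scale rat_scale ..

text \<open>Polymorphic in the field because the same polynomial is evaluated at the real number
  \<open>\<alpha>\<close> and at complex roots.\<close>

definition rat_eval :: "rat poly \<Rightarrow> 'a::field_char_0 \<Rightarrow> 'a" where
  "rat_eval p z = poly (map_poly of_rat p) z"

lemma rat_eval_pCons: "rat_eval (pCons c p) z = of_rat c + z * rat_eval p z"
  by (simp add: rat_eval_def map_poly_pCons)

lemma rat_eval_0 [simp]: "rat_eval 0 z = 0"
  by (simp add: rat_eval_def)

lemma rat_eval_1 [simp]: "rat_eval 1 z = 1"
  by (simp add: rat_eval_def)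

lemma rat_eval_add: "rat_eval (p + q) z = rat_eval p z + rat_eval q z"
  by (induction p q rule: poly_induct2) (simp_all add: rat_eval_pCons of_rat_add algebra_simps)

lemma rat_eval_diff: "rat_eval (p - q) z = rat_eval p z - rat_eval q z"
  using rat_eval_add[of "p - q" q z] by simp

lemma rat_eval_smult: "rat_eval (smult c p) z = of_rat c * rat_eval p z"
  by (induction p) (simp_all add: rat_eval_pCons of_rat_mult algebra_simps)

lemma rat_eval_mult: "rat_eval (p * q) z = rat_eval p z * rat_eval q z"
  by (induction p) (simp_all add: rat_eval_pCons rat_eval_add rat_eval_smult algebra_simps)

lemma rat_eval_monom: "rat_eval (monom c n) z = of_rat c * z ^ n"
  by (simp add: rat_eval_def map_poly_monom poly_monom)

lemma complex_of_real_of_rat: "complex_of_real (of_rat q) = of_rat q"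
  by (cases q) (simp add: of_rat_rat)

text \<open>Over the complex numbers \<open>p\<close> splits, and its constant term is the leading
  coefficient times the product of the negated roots.\<close>

lemma norm_coeff_0_of_norm_roots:
  fixes p :: "complex poly"
  assumes "p \<noteq> 0" and "\<And>z. poly p z = 0 \<Longrightarrow> norm z = r"
  shows "norm (coeff p 0) = norm (lead_coeff p) * r ^ degree p"
proof -
  obtain A where A: "size A = degree p" "p = smult (lead_coeff p) (\<Prod>x\<in>#A. [:-x, 1:])"
    using alg_closed_imp_factorization[OF assms(1)] by blast
  have "norm x = r" if "x \<in># A" for x
  proof (rule assms(2))
    have "poly p x = lead_coeff p * poly (\<Prod>x\<in>#A. [:-x, 1:]) x"
      by (subst A(2)) simp
    also have "poly (\<Prod>x\<in>#A. [:-x, 1:]) x = 0"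
      using that by (auto dest!: multi_member_split simp: poly_prod_mset)
    finally show "poly p x = 0" by simp
  qed
  hence *: "norm (poly (\<Prod>x\<in>#A. [:-x, 1:]) 0) = r ^ size A"
    by (induction A) (simp_all add: norm_mult)
  have "coeff p 0 = poly p 0"
    by (simp add: poly_0_coeff_0)
  also have "\<dots> = lead_coeff p * poly (\<Prod>x\<in>#A. [:-x, 1:]) 0"
    by (subst A(2)) simp
  finally show ?thesis
    using * A(1) by (simp add: norm_mult)
qed

text \<open>All complex roots of \<open>X^d - \<alpha>^d\<close> have modulus \<open>\<alpha>\<close>, so a rational factor of degree \<open>k\<close>
  makes \<open>\<alpha>^k\<close> rational.\<close>

lemma radical_inverse_poly:
  fixes \<alpha> :: real and f :: "rat poly"
  assumes pos: "\<alpha> > 0" and q: "\<alpha> ^ d = of_rat q"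
    and irr: "\<And>j. 0 < j \<Longrightarrow> j < d \<Longrightarrow> \<alpha> ^ j \<notin> \<rat>"
    and f: "f \<noteq> 0" "degree f < d"
  shows "\<exists>u. rat_eval u \<alpha> * rat_eval f \<alpha> = 1"
proof -
  define h where "h = monom 1 d - [:q:]"
  have ev_h: "rat_eval h z = z ^ d - of_rat q" for z :: "'b::field_char_0"
    by (simp add: h_def rat_eval_diff rat_eval_monom rat_eval_pCons)
  \<comment> \<open>\<open>h\<close> vanishes at \<open>\<alpha>\<close>. Once this gcd is known to
    be a unit, a Bezout relation evaluated at \<open>\<alpha>\<close> gives the inverse.\<close>
  define g where "g = gcd f h"
  have g0: "g \<noteq> 0" using f by (simp add: g_def)
  have "degree g \<le> degree f"
    using f by (simp add: g_def dvd_imp_degree_le)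
  hence deg: "degree g < d" using f by simp
  define G where "G = (map_poly of_rat g :: complex poly)"
  have G: "G \<noteq> 0" "degree G = degree g" "coeff G i = of_rat (coeff g i)" for i
    using g0 by (simp_all add: G_def map_poly_eq_0_iff degree_map_poly coeff_map_poly)
  have "norm z = \<alpha>" if "poly G z = 0" for z
  proof -
    have "g dvd h" by (simp add: g_def)
    then obtain k where "h = g * k" ..
    hence "rat_eval h z = 0"
      using that by (simp add: rat_eval_mult G_def flip: rat_eval_def)
    hence "z ^ d = of_rat q" by (simp add: ev_h)
    also have "of_rat q = complex_of_real (\<alpha> ^ d)"
      by (simp only: q complex_of_real_of_rat)
    finally have "norm z ^ d = \<alpha> ^ d"
      using pos by (metis norm_of_real norm_power abs_of_pos zero_less_power)
    thus ?thesis
      using pos deg by (metis power_eq_iff_eq_base norm_ge_zero less_imp_le gr_implies_not0 not_gr0)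
  qed
  from norm_coeff_0_of_norm_roots[OF G(1) this]
  have *: "norm (coeff G 0) = norm (lead_coeff G) * \<alpha> ^ degree g"
    by (simp add: G(2))
  have nr: "norm (of_rat x :: complex) = of_rat \<bar>x\<bar>" for x
    by (simp flip: complex_of_real_of_rat)
  have "of_rat \<bar>coeff g 0\<bar> = of_rat \<bar>lead_coeff g\<bar> * \<alpha> ^ degree g"
    using * by (simp add: G nr)
  hence "\<alpha> ^ degree g = of_rat (\<bar>coeff g 0\<bar> / \<bar>lead_coeff g\<bar>)"
    using g0 by (simp add: of_rat_divide)
  hence "\<alpha> ^ degree g \<in> \<rat>" by simp
  hence "degree g = 0" using irr deg by blast
  hence "is_unit g" using g0 by (simp add: is_unit_iff_degree)
  hence "gcd f h = 1" by (metis g_def is_unit_gcd_iff is_unit_gcd)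
  then obtain u v where "u * f + v * h = 1"
    by (metis bezout_coefficients_fst_snd)
  from arg_cong[OF this, of "\<lambda>p. rat_eval p \<alpha>"]
  have "rat_eval u \<alpha> * rat_eval f \<alpha> = 1"
    using q by (simp add: rat_eval_add rat_eval_mult ev_h)
  thus ?thesis ..
qed

section \<open>Multiplication by radicals and its trace\<close>

lemma rat_span_closed_rat_eval:
  assumes inv: "\<And>x. x \<in> U \<Longrightarrow> \<alpha> * x \<in> U" and U: "rat_real.subspace U" and x: "x \<in> U"
  shows "rat_eval p \<alpha> * x \<in> U"
proof (induction p)
  case 0
  show ?case using U by (simp add: rat_real.subspace_0)
next
  case (pCons c p)
  have "of_rat c * x + \<alpha> * (rat_eval p \<alpha> * x) \<in> U"
    using U x inv pCons by (intro rat_real.subspace_add rat_real.subspace_scale)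
  thus ?case by (simp add: rat_eval_pCons algebra_simps)
qed

text \<open>In such a basis the matrix of multiplication by \<open>\<alpha>\<close> has zero
  diagonal, hence trace \<open>0\<close>. The basis is assembled from cycles
  \<open>v, \<alpha> * v, ..., \<alpha> ^ (d - 1) * v\<close>: each vector goes to its successor,
  and the last one to a rational multiple of the first.\<close>

lemma adapted_basis:
  fixes \<alpha> :: real
  assumes W: "finite W"
    and inv: "\<And>x. x \<in> rat_real.span W \<Longrightarrow> \<alpha> * x \<in> rat_real.span W"
    and pos: "\<alpha> > 0" and b: "b > 0" "\<alpha> ^ b \<in> \<rat>" and irr: "\<alpha> \<notin> \<rat>"
  shows "\<exists>B. finite B \<and> rat_real.independent B \<and> rat_real.span B = rat_real.span W \<and>
    (\<forall>x\<in>B. \<alpha> * x \<in> rat_real.span (B - {x}))"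
proof -
  let ?span = rat_real.span
  \<comment> \<open>Minimality makes \<open>radical_inverse_poly\<close> applicable to all nonzero
    polynomials of degree below \<open>d\<close>; irrationality of \<open>\<alpha>\<close> gives
    \<open>d \<ge> 2\<close>.\<close>
  define d where "d = (LEAST d. d > 0 \<and> \<alpha> ^ d \<in> \<rat>)"
  have d: "d > 0" "\<alpha> ^ d \<in> \<rat>"
    using LeastI[of "\<lambda>d. d > 0 \<and> \<alpha> ^ d \<in> \<rat>" b] b by (auto simp: d_def)
  have irr_d: "\<alpha> ^ j \<notin> \<rat>" if "0 < j" "j < d" for j
    using not_less_Least[of j "\<lambda>d. d > 0 \<and> \<alpha> ^ d \<in> \<rat>"] that by (auto simp: d_def)
  have "d \<noteq> 1" using d irr by auto
  hence d2: "d \<ge> 2" using d(1) by simp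
  obtain q where q: "\<alpha> ^ d = of_rat q" using d(2) by (auto elim: Rats_cases)
  \<comment> \<open>\<open>P\<close> holds of the partial bases whose span is already invariant. The
    dimension bounds their size, so a largest one exists; if it did not span, a further cycle could
    be adjoined.\<close>
  define P where "P B \<longleftrightarrow> rat_real.independent B \<and> B \<subseteq> ?span W \<and>
    (\<forall>x\<in>?span B. \<alpha> * x \<in> ?span B) \<and> (\<forall>x\<in>B. \<alpha> * x \<in> ?span (B - {x}))" for B
  have fin: "finite B \<and> card B \<le> card W" if "P B" for B
    using rat_real.independent_span_bound[OF W] that by (auto simp: P_def)
  have "P {}" by (auto simp: P_def rat_real.independent_empty)
  then obtain B where B: "P B" and max: "\<And>C. P C \<Longrightarrow> card C \<le> card B"
    using ex_has_greatest_nat[of P "{}" card "Suc (card W)"] fin by (metis le_imp_less_Suc)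
  have "?span B = ?span W"
  proof (rule ccontr)
    assume "?span B \<noteq> ?span W"
    moreover have "?span B \<subseteq> ?span W"
      using B rat_real.span_minimal[of B "?span W"] by (auto simp: P_def)
    ultimately obtain v where v: "v \<in> ?span W" "v \<notin> ?span B" by auto
    have v0: "v \<noteq> 0" using v rat_real.span_zero[of B] by metis
    define C where "C j = B \<union> (\<lambda>i. \<alpha> ^ i * v) ` {..<j}" for j
    have span_C: "\<exists>u\<in>?span B. \<exists>f. (\<forall>i\<ge>j. coeff f i = 0) \<and> x = u + rat_eval f \<alpha> * v"
      if "x \<in> ?span (C j)" for x j
      using that
    proof (induction rule: rat_real.span_induct_alt)
      case base
      show ?case by (rule bexI[of _ 0], rule exI[of _ 0]) (auto simp: rat_real.span_zero)
    next
      case (step c x y)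
      then obtain u f where uf: "u \<in> ?span B" "\<forall>i\<ge>j. coeff f i = 0" "y = u + rat_eval f \<alpha> * v"
        by blast
      from step(1) consider "x \<in> B" | i where "i < j" "x = \<alpha> ^ i * v"
        by (auto simp: C_def)
      thus ?case
      proof cases
        case 1
        hence "of_rat c * x + u \<in> ?span B"
          using uf by (simp add: rat_real.span_add rat_real.span_scale rat_real.span_base)
        thus ?thesis using uf by (intro bexI[of _ "of_rat c * x + u"] exI[of _ f]) auto
      next
        case 2
        thus ?thesis using uf
          by (intro bexI[of _ u] exI[of _ "monom c i + f"])
            (auto simp: rat_eval_add rat_eval_monom algebra_simps)
      qed
    qed
    have indep: "rat_real.independent (C j)" if "j \<le> d" for j
      using that
    proof (induction j)
      case 0
      show ?case using B by (simp add: C_def P_def)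
    next
      case (Suc j)
      \<comment> \<open>A relation puts \<open>rat_eval g \<alpha> * v\<close> into the invariant
        span of \<open>B\<close> for a nonzero \<open>g\<close> of degree below \<open>d\<close>.
        The inverse of \<open>rat_eval g \<alpha>\<close> is again a polynomial in
        \<open>\<alpha>\<close>, so \<open>v\<close> would lie in that span.\<close>
      have "\<alpha> ^ j * v \<notin> ?span (C j)"
      proof
        assume "\<alpha> ^ j * v \<in> ?span (C j)"
        from span_C[OF this] obtain u f where uf: "u \<in> ?span B" "\<forall>i\<ge>j. coeff f i = 0"
          "\<alpha> ^ j * v = u + rat_eval f \<alpha> * v" by blast
        define g where "g = monom 1 j - f"
        have "coeff g j = 1" using uf by (simp add: g_def)
        hence "g \<noteq> 0" by auto
        have "degree g \<le> j"
          using uf by (intro degree_le) (simp add: g_def)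
        hence "degree g < d" using Suc by simp
        from radical_inverse_poly[OF pos q irr_d \<open>g \<noteq> 0\<close> this]
        obtain w where w: "rat_eval w \<alpha> * rat_eval g \<alpha> = 1" by blast
        have "rat_eval g \<alpha> * v = u"
          using uf by (simp add: g_def rat_eval_diff rat_eval_monom algebra_simps)
        hence "rat_eval w \<alpha> * u = v"
          using w by (metis mult.assoc mult_1)
        moreover have "rat_eval w \<alpha> * u \<in> ?span B"
          using B uf by (intro rat_span_closed_rat_eval) (auto simp: P_def)
        ultimately show False using v by simp
      qed
      moreover have "C (Suc j) = insert (\<alpha> ^ j * v) (C j)"
        by (auto simp: C_def lessThan_Suc)
      ultimately show ?case
        using Suc by (simp add: rat_real.independent_insertI)
    qed
    have pow_v: "\<alpha> ^ i * v \<in> ?span W" for i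
      by (induction i) (use v inv in \<open>auto simp: mult.assoc\<close>)
    have diag: "\<alpha> * x \<in> ?span (C d - {x})" if x: "x \<in> C d" for x
    proof (cases "x \<in> B")
      case True
      hence "\<alpha> * x \<in> ?span (B - {x})" using B by (auto simp: P_def)
      moreover have "?span (B - {x}) \<subseteq> ?span (C d - {x})"
        by (rule rat_real.span_mono) (auto simp: C_def)
      ultimately show ?thesis by auto
    next
      case False
      then obtain i where i: "i < d" "x = \<alpha> ^ i * v" using x by (auto simp: C_def)
      show ?thesis
      proof (cases "Suc i < d")
        case True
        have "\<alpha> ^ Suc i * v \<noteq> x"
          using v0 pos irr i by auto
        moreover have "\<alpha> ^ Suc i * v \<in> C d" unfolding C_def using True by blast
        ultimately have "\<alpha> ^ Suc i * v \<in> ?span (C d - {x})" by (simp add: rat_real.span_base)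
        thus ?thesis using i by (simp add: mult.assoc)
      next
        case False
        \<comment> \<open>The cycle closes here: \<open>\<alpha> * x\<close> is a rational multiple
          of \<open>v\<close>, and \<open>v\<close> differs from \<open>x\<close> because
          \<open>0 < i < d\<close>.\<close>
        hence id: "Suc i = d" "i > 0" using i d2 by auto
        have "\<alpha> ^ i \<noteq> 1" using irr_d[of i] id i by (metis Rats_1)
        hence "v \<noteq> x" using i v0 by auto
        moreover have "v \<in> C d" using d2 by (auto simp: C_def intro!: image_eqI[of _ _ 0])
        ultimately have "of_rat q * v \<in> ?span (C d - {x})"
          by (intro rat_real.span_scale rat_real.span_base) auto
        moreover have "\<alpha> * x = of_rat q * v" using i id q by (metis mult.assoc power_Suc)
        ultimately show ?thesis by simp
      qed
    qed
    have "\<alpha> * x \<in> ?span (C d)" if "x \<in> ?span (C d)" for x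
      using that
    proof (induction rule: rat_real.span_induct_alt)
      case base
      show ?case by (simp add: rat_real.span_zero)
    next
      case (step c x y)
      have "\<alpha> * x \<in> ?span (C d)"
        using diag[OF step(1)] rat_real.span_mono[of "C d - {x}" "C d"] by auto
      hence "of_rat c * (\<alpha> * x) + \<alpha> * y \<in> ?span (C d)"
        using step by (intro rat_real.span_add rat_real.span_scale)
      thus ?case by (simp add: algebra_simps)
    qed
    moreover have "C d \<subseteq> ?span W"
      using B pow_v by (auto simp: C_def P_def)
    ultimately have "P (C d)"
      using diag indep by (auto simp: P_def)
    moreover have "B \<subset> C d"
    proof -
      have "v \<in> C d" using d2 by (auto simp: C_def intro!: image_eqI[of _ _ 0])
      moreover have "v \<notin> B" using v rat_real.span_base by auto
      ultimately show ?thesis by (auto simp: C_def)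
    qed
    ultimately show False
      using max[of "C d"] fin[of "C d"] psubset_card_mono[of "C d" B] by auto
  qed
  thus ?thesis using B fin[OF B] by (auto simp: P_def intro!: exI[of _ B])
qed

text \<open>The trace over the rationals of multiplication by \<open>\<alpha>\<close> on the span of
  \<open>B\<close>, provided that \<open>B\<close> is a finite basis of an invariant space.\<close>

definition rat_trace :: "real set \<Rightarrow> real \<Rightarrow> rat" where
  "rat_trace B \<alpha> = (\<Sum>b\<in>B. rat_real.representation B (\<alpha> * b) b)"

text \<open>This is \<open>tr (X Y) = tr (Y X)\<close>: expanding \<open>B\<close> in terms of
  \<open>C\<close>, and the images of \<open>C\<close> in terms of \<open>B\<close>, turns both
  traces into the same double sum.\<close>

lemma rat_trace_basis_independent:
  assumes B: "finite B" "rat_real.independent B" and C: "finite C" "rat_real.independent C"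
    and span: "rat_real.span B = rat_real.span C"
    and inv: "\<And>x. x \<in> rat_real.span C \<Longrightarrow> \<alpha> * x \<in> rat_real.span C"
  shows "rat_trace B \<alpha> = rat_trace C \<alpha>"
proof -
  let ?rep = rat_real.representation
  have in_span: "\<alpha> * x \<in> rat_real.span B" "x \<in> rat_real.span B" "\<alpha> * x \<in> rat_real.span C" "x \<in> rat_real.span C"
    if "x \<in> B \<or> x \<in> C" for x
    using that inv span rat_real.span_base by blast+
  have "rat_trace B \<alpha> = (\<Sum>b\<in>B. \<Sum>c\<in>C. ?rep C b c * ?rep B (\<alpha> * c) b)"
    unfolding rat_trace_def
  proof (intro sum.cong refl)
    fix b assume b: "b \<in> B"
    have "b = (\<Sum>c\<in>C. of_rat (?rep C b c) * c)"
      using rat_real.sum_representation_eq[OF C(2) _ C(1), of b] in_span b by simp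
    hence "\<alpha> * b = (\<Sum>c\<in>C. of_rat (?rep C b c) * (\<alpha> * c))"
      by (metis (no_types, lifting) mult.left_commute sum.cong sum_distrib_left)
    also have "?rep B \<dots> b = (\<Sum>c\<in>C. ?rep C b c * ?rep B (\<alpha> * c) b)"
      using in_span by (simp add: rat_real.representation_sum[OF B(2)]
          rat_real.representation_scale[OF B(2)] rat_real.span_scale)
    finally show "?rep B (\<alpha> * b) b = (\<Sum>c\<in>C. ?rep C b c * ?rep B (\<alpha> * c) b)" .
  qed
  also have "\<dots> = (\<Sum>c\<in>C. \<Sum>b\<in>B. ?rep B (\<alpha> * c) b * ?rep C b c)"
    by (subst sum.swap) (simp add: mult.commute)
  also have "\<dots> = rat_trace C \<alpha>"
    unfolding rat_trace_def
  proof (intro sum.cong refl)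
    fix c assume c: "c \<in> C"
    have "?rep C (\<alpha> * c) c = ?rep C (\<Sum>b\<in>B. of_rat (?rep B (\<alpha> * c) b) * b) c"
      using rat_real.sum_representation_eq[OF B(2) _ B(1), of "\<alpha> * c"] in_span c by simp
    also have "\<dots> = (\<Sum>b\<in>B. ?rep B (\<alpha> * c) b * ?rep C b c)"
      using in_span by (simp add: rat_real.representation_sum[OF C(2)]
          rat_real.representation_scale[OF C(2)] rat_real.span_scale)
    finally show "(\<Sum>b\<in>B. ?rep B (\<alpha> * c) b * ?rep C b c) = ?rep C (\<alpha> * c) c" by simp
  qed
  finally show ?thesis .
qed

text \<open>Supplies one finite-dimensional space on which all the radicals act, so that their
  traces can be added. A new radical \<open>\<rho>\<close> is adjoined through its powers below
  \<open>b\<close>; the power \<open>\<rho> ^ b\<close> is rational and wraps around.\<close>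

lemma finite_span_closed_radicals:
  fixes P :: "real set"
  assumes "finite P" and "\<And>\<rho>. \<rho> \<in> P \<Longrightarrow> \<rho> ^ b \<in> \<rat>" and b: "b > 0"
  shows "\<exists>W. finite W \<and> 1 \<in> rat_real.span W \<and>
    (\<forall>\<rho>\<in>P. \<forall>x\<in>rat_real.span W. \<rho> * x \<in> rat_real.span W)"
  using assms(1,2)
proof (induction P)
  case empty
  show ?case by (rule exI[of _ "{1}"]) (simp add: rat_real.span_base)
next
  case (insert \<rho> P)
  let ?span = rat_real.span
  obtain W where W: "finite W" "1 \<in> ?span W" "\<And>\<sigma> x. \<sigma> \<in> P \<Longrightarrow> x \<in> ?span W \<Longrightarrow> \<sigma> * x \<in> ?span W"
    using insert by auto
  define W' where "W' = (\<lambda>(j, w). \<rho> ^ j * w) ` ({..<b} \<times> W)"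
  have pow: "\<rho> ^ j * x \<in> ?span W'" if "j < b" "x \<in> ?span W" for j x
    using that(2)
  proof (induction rule: rat_real.span_induct_alt)
    case base
    show ?case by (simp add: rat_real.span_zero)
  next
    case (step c x y)
    have "\<rho> ^ j * x \<in> ?span W'"
      using step that by (intro rat_real.span_base) (auto simp: W'_def)
    hence "of_rat c * (\<rho> ^ j * x) + \<rho> ^ j * y \<in> ?span W'"
      using step by (intro rat_real.span_add rat_real.span_scale)
    thus ?case by (simp add: algebra_simps)
  qed
  have lift: "\<sigma> * x \<in> ?span W'" if x: "x \<in> ?span W'"
    and gen: "\<And>j w. j < b \<Longrightarrow> w \<in> W \<Longrightarrow> \<sigma> * (\<rho> ^ j * w) \<in> ?span W'" for \<sigma> x
    using x
  proof (induction rule: rat_real.span_induct_alt)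
    case base
    show ?case by (simp add: rat_real.span_zero)
  next
    case (step c x y)
    have "\<sigma> * x \<in> ?span W'"
      using step gen by (auto simp: W'_def)
    hence "of_rat c * (\<sigma> * x) + \<sigma> * y \<in> ?span W'"
      using step by (intro rat_real.span_add rat_real.span_scale)
    thus ?case by (simp add: algebra_simps)
  qed
  have "\<sigma> * x \<in> ?span W'" if "\<sigma> \<in> insert \<rho> P" "x \<in> ?span W'" for \<sigma> x
    using that(2)
  proof (rule lift)
    fix j w assume jw: "j < b" "w \<in> W"
    show "\<sigma> * (\<rho> ^ j * w) \<in> ?span W'"
    proof (cases "\<sigma> \<in> P")
      case True
      hence "\<rho> ^ j * (\<sigma> * w) \<in> ?span W'"
        using jw W by (intro pow) (auto simp: rat_real.span_base)
      thus ?thesis by (simp add: algebra_simps)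
    next
      case False
      hence [simp]: "\<sigma> = \<rho>" using that by simp
      show ?thesis
      proof (cases "Suc j < b")
        case True
        have "\<rho> ^ Suc j * w \<in> ?span W'"
          using jw by (intro pow True) (auto simp: rat_real.span_base)
        thus ?thesis by (simp add: mult.assoc)
      next
        case False
        hence "b = Suc j" using jw by simp
        have "\<rho> ^ b \<in> \<rat>" using insert.prems by simp
        then obtain q where q: "\<rho> ^ b = of_rat q" by (rule Rats_cases)
        have "\<rho> ^ 0 * w \<in> ?span W'"
          using jw b by (intro pow) (auto simp: rat_real.span_base)
        hence "of_rat q * (\<rho> ^ 0 * w) \<in> ?span W'" by (rule rat_real.span_scale)
        thus ?thesis using \<open>b = Suc j\<close> by (simp add: q[symmetric] mult.assoc)
      qed
    qed
  qed
  moreover have "finite W'" using W by (simp add: W'_def)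
  moreover have "1 \<in> ?span W'" using pow[OF b W(2)] b pow[of 0 1] W by simp
  ultimately show ?case by blast
qed

text \<open>Multiplication by an irrational radical has trace \<open>0\<close> and multiplication by \<open>c\<close> has trace
  \<open>c\<close> times the dimension, so taking traces isolates \<open>c\<close>.\<close>

lemma rational_part_eq_0:
  fixes P :: "real set" and k :: "real \<Rightarrow> rat"
  assumes fin: "finite P" and P: "\<And>\<rho>. \<rho> \<in> P \<Longrightarrow> \<rho> > 0 \<and> \<rho> ^ b \<in> \<rat> \<and> \<rho> \<notin> \<rat>" and b: "b > 0"
    and eq: "of_rat c + (\<Sum>\<rho>\<in>P. of_rat (k \<rho>) * \<rho>) = 0"
  shows "c = 0"
proof -
  let ?span = rat_real.span and ?rep = rat_real.representation
  obtain W where W: "finite W" "1 \<in> ?span W" "\<And>\<sigma> x. \<sigma> \<in> P \<Longrightarrow> x \<in> ?span W \<Longrightarrow> \<sigma> * x \<in> ?span W"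
    using finite_span_closed_radicals[OF fin _ b] P by blast
  obtain B where B: "B \<subseteq> W" "rat_real.independent B" "W \<subseteq> ?span B"
    by (rule rat_real.maximal_independent_subset)
  hence spanB: "?span B = ?span W"
    by (intro antisym rat_real.span_mono rat_real.span_minimal rat_real.subspace_span)
  have finB: "finite B" using B W finite_subset by blast
  have trace: "rat_trace B \<rho> = 0" if \<rho>: "\<rho> \<in> P" for \<rho>
  proof -
    obtain C where C: "finite C" "rat_real.independent C" "?span C = ?span W"
      "\<And>x. x \<in> C \<Longrightarrow> \<rho> * x \<in> ?span (C - {x})"
      using adapted_basis[OF W(1) W(3)[OF \<rho>] _ b] P[OF \<rho>] by blast
    have "?rep C (\<rho> * x) x = 0" if "x \<in> C" for x
      using rat_real.representation_extend[OF C(2) C(4)[OF that]] rat_real.representation_ne_zero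
      by (metis Diff_iff Diff_subset singletonI)
    hence "rat_trace C \<rho> = 0" by (simp add: rat_trace_def)
    thus ?thesis
      using rat_trace_basis_independent[OF finB B(2) C(1,2)] spanB C(3) W(3)[OF \<rho>] by simp
  qed
  have "0 = (\<Sum>x\<in>B. ?rep B ((of_rat c + (\<Sum>\<rho>\<in>P. of_rat (k \<rho>) * \<rho>)) * x) x)"
    by (simp add: eq rat_real.representation_zero)
  also have "\<dots> = (\<Sum>x\<in>B. c + (\<Sum>\<rho>\<in>P. k \<rho> * ?rep B (\<rho> * x) x))"
  proof (intro sum.cong refl)
    fix x assume x: "x \<in> B"
    have in_span: "x \<in> ?span B" "\<And>\<rho>. \<rho> \<in> P \<Longrightarrow> \<rho> * x \<in> ?span B"
      using x W(3) rat_real.span_base[of x B] by (auto simp: spanB)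
    have "(of_rat c + (\<Sum>\<rho>\<in>P. of_rat (k \<rho>) * \<rho>)) * x = of_rat c * x + (\<Sum>\<rho>\<in>P. of_rat (k \<rho>) * (\<rho> * x))"
      by (simp add: algebra_simps sum_distrib_left sum_distrib_right)
    also have "?rep B \<dots> x = c + (\<Sum>\<rho>\<in>P. k \<rho> * ?rep B (\<rho> * x) x)"
      using in_span x by (simp add: rat_real.representation_add[OF B(2)] rat_real.representation_sum[OF B(2)]
          rat_real.representation_scale[OF B(2)] rat_real.span_scale rat_real.span_sum
          rat_real.representation_basis[OF B(2)])
    finally show "?rep B ((of_rat c + (\<Sum>\<rho>\<in>P. of_rat (k \<rho>) * \<rho>)) * x) x = c + (\<Sum>\<rho>\<in>P. k \<rho> * ?rep B (\<rho> * x) x)" .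
  qed
  also have "\<dots> = of_nat (card B) * c + (\<Sum>\<rho>\<in>P. k \<rho> * rat_trace B \<rho>)"
    unfolding sum.distrib rat_trace_def by (subst sum.swap) (simp add: sum_distrib_left)
  also have "\<dots> = of_nat (card B) * c"
    using trace by simp
  finally have "of_nat (card B) * c = 0" by simp
  \<comment> \<open>The dimension is not zero because \<open>1\<close> lies in the space.\<close>
  moreover have "B \<noteq> {}"
    using W(2) spanB by auto
  ultimately show ?thesis using finB by simp
qed

text \<open>Dividing a linear relation by one of its members \<open>\<eta>\<close> leaves the
  coefficient of \<open>\<eta>\<close> plus a combination of irrational radicals, so
  \<open>rational_part_eq_0\<close> makes that coefficient vanish.\<close>

lemma independent_radicals:
  fixes \<Theta> :: "real set"
  assumes b: "b > 0" and pos: "\<And>\<theta>. \<theta> \<in> \<Theta> \<Longrightarrow> \<theta> > 0" and rat: "\<And>\<theta>. \<theta> \<in> \<Theta> \<Longrightarrow> \<theta> ^ b \<in> \<rat>"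
    and incomm: "\<And>\<theta> \<eta>. \<theta> \<in> \<Theta> \<Longrightarrow> \<eta> \<in> \<Theta> \<Longrightarrow> \<theta> \<noteq> \<eta> \<Longrightarrow> \<theta> / \<eta> \<notin> \<rat>"
  shows "rat_real.independent \<Theta>"
proof
  assume "rat_real.dependent \<Theta>"
  then obtain S k \<eta> where S: "finite S" "S \<subseteq> \<Theta>" "\<eta> \<in> S" "k \<eta> \<noteq> 0"
    "(\<Sum>v\<in>S. of_rat (k v) * v) = 0"
    by (auto simp: rat_real.dependent_explicit)
  have \<eta>: "\<eta> > 0" "\<eta> ^ b \<in> \<rat>" "\<eta> \<in> \<Theta>" using S pos rat by auto
  define P where "P = (\<lambda>v. v / \<eta>) ` (S - {\<eta>})"
  have inj: "inj_on (\<lambda>v. v / \<eta>) (S - {\<eta>})" using \<eta> by (auto simp: inj_on_def)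
  have "0 = (\<Sum>v\<in>S. of_rat (k v) * v) / \<eta>" using S by simp
  also have "\<dots> = (of_rat (k \<eta>) * \<eta> + (\<Sum>v\<in>S - {\<eta>}. of_rat (k v) * v)) / \<eta>"
    using S by (simp add: sum.remove)
  also have "\<dots> = of_rat (k \<eta>) + (\<Sum>v\<in>S - {\<eta>}. of_rat (k v) * (v / \<eta>))"
    using \<eta> by (simp add: add_divide_distrib sum_divide_distrib)
  also have "(\<Sum>v\<in>S - {\<eta>}. of_rat (k v) * (v / \<eta>)) = (\<Sum>\<rho>\<in>P. of_rat (k (\<rho> * \<eta>)) * \<rho>)"
    unfolding P_def using \<eta> by (subst sum.reindex[OF inj]) simp
  finally have "k \<eta> = 0"
    using S \<eta> pos rat incomm
    by (intro rational_part_eq_0[of P b "k \<eta>" "\<lambda>\<rho>. k (\<rho> * \<eta>)"] b)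
      (auto simp: P_def power_divide subset_iff)
  thus False using S by simp
qed

lemma additive_extension:
  fixes f :: "real \<Rightarrow> real"
  assumes "rat_real.independent B"
  shows "\<exists>g :: real \<Rightarrow> real. (\<forall>x y. g (x + y) = g x + g y) \<and> (\<forall>x\<in>B. g x = f x)"
proof -
  obtain g where g: "Vector_Spaces.linear rat_scale rat_scale g" "\<forall>x\<in>B. g x = f x"
    using rat_real_pair.linear_independent_extend[OF assms, of f] by blast
  interpret g: Vector_Spaces.linear rat_scale rat_scale g by fact
  show ?thesis using g(2) g.add by blast
qed

section \<open>Strata of the integers\<close>

definition power_free :: "nat \<Rightarrow> nat \<Rightarrow> bool" where
  "power_free b m \<longleftrightarrow> m > 0 \<and> (\<forall>t. t ^ b dvd m \<longrightarrow> t = 1)"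

definition stratum :: "nat \<Rightarrow> nat \<Rightarrow> nat set" where
  "stratum b s = {s ^ b * m |m. power_free b m}"

text \<open>The equation says that the \<open>a\<close>-th power of \<open>m / n\<close> is a
  \<open>b\<close>-th power of a rational. Comparing the exponents of a prime and using coprimality,
  \<open>b\<close> divides the difference of its multiplicities in \<open>m\<close> and
  \<open>n\<close>; both are below \<open>b\<close>, so they agree.\<close>

lemma power_free_eqI:
  fixes m n a b p q :: nat
  assumes m: "power_free b m" and n: "power_free b n" and ab: "coprime a b" and pq: "p > 0" "q > 0"
    and eq: "m ^ a * q ^ b = n ^ a * p ^ b"
  shows "m = n"
proof (rule multiplicity_eq_nat)
  show "m > 0" "n > 0" using m n by (auto simp: power_free_def)
next
  fix r :: nat assume r: "prime r"
  have less: "multiplicity r k < b" if "power_free b k" for k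
  proof (rule ccontr)
    assume "\<not> multiplicity r k < b"
    hence "r ^ b dvd k" by (intro multiplicity_dvd') simp
    hence "r = 1" using that by (auto simp: power_free_def)
    thus False using r by simp
  qed
  have "multiplicity r (m ^ a * q ^ b) = multiplicity r (n ^ a * p ^ b)" by (simp add: eq)
  hence "a * multiplicity r m + b * multiplicity r q = a * multiplicity r n + b * multiplicity r p"
    using r pq m n
    by (simp add: prime_elem_multiplicity_mult_distrib prime_elem_multiplicity_power_distrib power_free_def)
  hence "int a * (int (multiplicity r m) - int (multiplicity r n)) =
      int b * (int (multiplicity r p) - int (multiplicity r q))"
    by (simp add: algebra_simps flip: of_nat_mult of_nat_add)
  hence "int b dvd int a * (int (multiplicity r m) - int (multiplicity r n))" by simp
  hence dvd: "int b dvd int (multiplicity r m) - int (multiplicity r n)"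
    using ab by (simp add: coprime_dvd_mult_right_iff coprime_commute)
  have "int (multiplicity r m) - int (multiplicity r n) = 0"
  proof (rule ccontr)
    assume "int (multiplicity r m) - int (multiplicity r n) \<noteq> 0"
    from dvd_imp_le_int[OF this dvd] show False
      using less[OF m] less[OF n] by linarith
  qed
  thus "multiplicity r m = multiplicity r n" by simp
qed

text \<open>In a ratio of two of these powers the common factor \<open>s ^ b\<close> cancels. If the
  ratio were rational, \<open>power_free_eqI\<close> would identify the two power-free
  parts.\<close>

lemma independent_stratum_powers:
  fixes a b s :: nat
  assumes ab: "coprime a b" and b: "b > 0" and s: "s > 0"
  shows "rat_real.independent ((\<lambda>n. real n powr (real a / real b)) ` stratum b s)"
proof (rule independent_radicals[OF b])
  let ?\<alpha> = "real a / real b"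
  have pow_b: "(real n powr ?\<alpha>) ^ b = real n ^ a" if "n > 0" for n
  proof -
    have "(real n powr ?\<alpha>) ^ b = (real n powr ?\<alpha>) powr real b"
      using that by (simp add: powr_realpow)
    also have "\<dots> = real n powr real a"
      using b by (simp add: powr_powr)
    finally show ?thesis using that by (simp add: powr_realpow)
  qed
  have pos: "n > 0" if "n \<in> stratum b s" for n
    using that s by (auto simp: stratum_def power_free_def)
  fix \<theta> assume "\<theta> \<in> (\<lambda>n. real n powr ?\<alpha>) ` stratum b s"
  then obtain n where n: "n \<in> stratum b s" "\<theta> = real n powr ?\<alpha>" by auto
  show "\<theta> > 0" using n pos by auto
  show "\<theta> ^ b \<in> \<rat>" using n pos pow_b by auto
  fix \<eta> assume "\<eta> \<in> (\<lambda>n. real n powr ?\<alpha>) ` stratum b s" and neq: "\<theta> \<noteq> \<eta>"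
  then obtain n' where n': "n' \<in> stratum b s" "\<eta> = real n' powr ?\<alpha>" by auto
  obtain m m' where m: "n = s ^ b * m" "power_free b m" "n' = s ^ b * m'" "power_free b m'"
    using n n' by (auto simp: stratum_def)
  show "\<theta> / \<eta> \<notin> \<rat>"
  proof
    assume "\<theta> / \<eta> \<in> \<rat>"
    then obtain p q :: nat where pq: "q \<noteq> 0" "\<bar>\<theta> / \<eta>\<bar> = real p / real q"
      by (rule Rats_abs_nat_div_natE)
    have \<theta>\<eta>: "\<theta> > 0" "\<eta> > 0" using n n' pos by auto
    hence p: "\<theta> / \<eta> = real p / real q" "p > 0" using pq by (auto intro!: gr0I)
    have "(real p / real q) ^ b = (\<theta> / \<eta>) ^ b" by (simp add: p)
    also have "\<dots> = real n ^ a / real n' ^ a"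
      using n n' pos pow_b by (simp add: power_divide)
    also have "\<dots> = real m ^ a / real m' ^ a"
      using s by (simp add: m power_mult_distrib)
    finally have "real p ^ b / real q ^ b = real m ^ a / real m' ^ a"
      by (simp add: power_divide)
    moreover have "m' > 0" using m by (simp add: power_free_def)
    ultimately have "real m ^ a * real q ^ b = real m' ^ a * real p ^ b"
      using pq by (simp add: field_simps)
    hence "m ^ a * q ^ b = m' ^ a * p ^ b"
      by (simp flip: of_nat_power of_nat_mult)
    hence "m = m'" using m ab pq p by (intro power_free_eqI[of b m m' a p q]) auto
    thus False using neq n n' m by simp
  qed
qed

section \<open>Density of the integers outside the first strata\<close>

lemma in_stratum_max:
  fixes n b :: nat
  assumes "n > 0" "b > 0"
  shows "\<exists>s>0. s \<le> n \<and> s ^ b dvd n \<and> n \<in> stratum b s"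
proof -
  let ?A = "{s. s ^ b dvd n}"
  have le: "s \<le> n" if "s ^ b dvd n" for s
  proof -
    have "s dvd n" using that assms by (meson dvd_power dvd_trans)
    thus ?thesis using assms by (simp add: dvd_imp_le)
  qed
  hence fin: "finite ?A" by (metis (no_types, lifting) finite_nat_set_iff_bounded_le mem_Collect_eq)
  have 1: "1 \<in> ?A" by simp
  \<comment> \<open>The greatest \<open>s\<close> whose \<open>b\<close>-th power divides
    \<open>n\<close>: a factor \<open>t ^ b\<close> of the quotient would make \<open>s * t\<close>
    another candidate, which forces \<open>t = 1\<close>.\<close>
  define s where "s = Max ?A"
  have sA: "s \<in> ?A" unfolding s_def using fin 1 by (metis Max_in empty_iff)
  then obtain m where m: "n = s ^ b * m" by auto
  have "s \<ge> 1" unfolding s_def using fin 1 by simp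
  have "power_free b m"
    unfolding power_free_def
  proof (intro conjI allI impI)
    show m0: "m > 0" using m assms by (auto intro: gr0I)
    fix t assume t: "t ^ b dvd m"
    hence "(s * t) ^ b dvd n" by (simp add: m power_mult_distrib)
    hence "s * t \<le> s" unfolding s_def using fin by (intro Max_ge) (simp_all add: s_def)
    moreover have "t > 0" using t m0 assms by (auto intro!: gr0I)
    ultimately show "t = 1" using \<open>s \<ge> 1\<close> by simp
  qed
  hence "n \<in> stratum b s" using m by (auto simp: stratum_def)
  thus ?thesis using sA \<open>s \<ge> 1\<close> le by (intro exI[of _ s]) auto
qed

lemma card_multiples_le:
  assumes "d > 0"
  shows "real (card {n\<in>{1..N}. d dvd n}) \<le> real N / real d"
proof -
  have "{n\<in>{1..N}. d dvd n} \<subseteq> (\<lambda>k. d * k) ` {1..N div d}"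
  proof
    fix n assume "n \<in> {n\<in>{1..N}. d dvd n}"
    then obtain k where "n = d * k" "1 \<le> d * k" "d * k \<le> N" by auto
    thus "n \<in> (\<lambda>k. d * k) ` {1..N div d}"
      using assms by (auto intro!: imageI simp: less_eq_div_iff_mult_less_eq mult.commute Suc_le_eq)
  qed
  hence "card {n\<in>{1..N}. d dvd n} \<le> card ((\<lambda>k. d * k) ` {1..N div d})"
    by (intro card_mono) auto
  also have "\<dots> \<le> N div d" using card_image_le[of "{1..N div d}" "\<lambda>k. d * k"] by simp
  finally have "real (card {n\<in>{1..N}. d dvd n}) \<le> real (N div d)" by simp
  also have "\<dots> \<le> real N / real d" by (rule of_nat_div_le_of_nat)
  finally show ?thesis .
qed

text \<open>Telescoping, as \<open>1 / s^2\<close> is at most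
  \<open>1 / (s - 1) - 1 / s\<close>.\<close>

lemma sum_inverse_squares_tail:
  assumes "S > 0" "S \<le> N"
  shows "(\<Sum>s\<in>{S<..N}. 1 / (real s)\<^sup>2) \<le> 1 / real S - 1 / real N"
  using assms(2)
proof (induction N rule: dec_induct)
  case base
  show ?case by simp
next
  case (step N)
  have N: "real N > 0" using step assms by simp
  have "{S<..Suc N} = insert (Suc N) {S<..N}" using step by auto
  hence "(\<Sum>s\<in>{S<..Suc N}. 1 / (real s)\<^sup>2) \<le> 1 / (real (Suc N))\<^sup>2 + (1 / real S - 1 / real N)"
    using step by simp
  also have "1 / (real (Suc N))\<^sup>2 \<le> 1 / real N - 1 / real (Suc N)"
  proof -
    have "1 / real N - 1 / real (Suc N) = 1 / (real N * real (Suc N))"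
      using N by (simp add: field_simps)
    moreover have "1 / (real (Suc N))\<^sup>2 \<le> 1 / (real N * real (Suc N))"
      using N by (intro divide_left_mono) (auto simp: power2_eq_square)
    ultimately show ?thesis by simp
  qed
  finally show ?case by simp
qed

text \<open>An integer missed by the first \<open>S\<close> strata lies in a stratum
  \<open>s > S\<close>, hence is a multiple of \<open>s ^ b\<close>. Up to \<open>N\<close> there
  are at most \<open>N / s^2\<close> of these for each \<open>s\<close>, because
  \<open>b \<ge> 2\<close>. If \<open>N < S\<close> nothing is missed, since \<open>n\<close> lies
  in a stratum of index at most \<open>n\<close>.\<close>

lemma card_not_in_strata_le:
  assumes b: "b \<ge> 2" and S: "S > 0"
  shows "real (card {n\<in>{1..N}. \<forall>s\<in>{1..S}. n \<notin> stratum b s}) \<le> real N / real S"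
proof (cases "S \<le> N")
  case False
  have "{n\<in>{1..N}. \<forall>s\<in>{1..S}. n \<notin> stratum b s} = {}"
  proof -
    have "\<exists>s\<in>{1..S}. n \<in> stratum b s" if "n \<in> {1..N}" for n
    proof -
      have "n > 0" "b > 0" using that b by auto
      from in_stratum_max[OF this] obtain s where s: "s > 0" "s \<le> n" "n \<in> stratum b s" by blast
      thus ?thesis using that False by (intro bexI[of _ s]) auto
    qed
    thus ?thesis by blast
  qed
  thus ?thesis by (simp only: card.empty) simp
next
  case True
  have "{n\<in>{1..N}. \<forall>s\<in>{1..S}. n \<notin> stratum b s} \<subseteq> (\<Union>s\<in>{S<..N}. {n\<in>{1..N}. s ^ b dvd n})"
  proof
    fix n assume n: "n \<in> {n\<in>{1..N}. \<forall>s\<in>{1..S}. n \<notin> stratum b s}"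
    have "n > 0" "b > 0" using n b by auto
    from in_stratum_max[OF this] obtain s
      where s: "s > 0" "s \<le> n" "s ^ b dvd n" "n \<in> stratum b s" by blast
    have "\<not> s \<le> S" using s n by auto
    thus "n \<in> (\<Union>s\<in>{S<..N}. {n\<in>{1..N}. s ^ b dvd n})" using n s by auto
  qed
  hence "card {n\<in>{1..N}. \<forall>s\<in>{1..S}. n \<notin> stratum b s} \<le> card (\<Union>s\<in>{S<..N}. {n\<in>{1..N}. s ^ b dvd n})"
    by (intro card_mono) auto
  also have "\<dots> \<le> (\<Sum>s\<in>{S<..N}. card {n\<in>{1..N}. s ^ b dvd n})"
    by (rule card_UN_le) simp
  finally have "real (card {n\<in>{1..N}. \<forall>s\<in>{1..S}. n \<notin> stratum b s}) \<le>
      (\<Sum>s\<in>{S<..N}. real (card {n\<in>{1..N}. s ^ b dvd n}))"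
    by (simp flip: of_nat_sum)
  also have "\<dots> \<le> (\<Sum>s\<in>{S<..N}. real N * (1 / (real s)\<^sup>2))"
  proof (rule sum_mono)
    fix s assume s: "s \<in> {S<..N}"
    have "real (card {n\<in>{1..N}. s ^ b dvd n}) \<le> real N / real (s ^ b)"
      using s by (intro card_multiples_le) auto
    also have "\<dots> \<le> real N / (real s)\<^sup>2"
      using s b power_increasing[of 2 b "real s"] by (intro divide_left_mono) auto
    finally show "real (card {n\<in>{1..N}. s ^ b dvd n}) \<le> real N * (1 / (real s)\<^sup>2)" by simp
  qed
  also have "\<dots> = real N * (\<Sum>s\<in>{S<..N}. 1 / (real s)\<^sup>2)"
    by (simp add: sum_distrib_left)
  also have "\<dots> \<le> real N * (1 / real S)"
  proof (rule mult_left_mono)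
    have "1 / real N \<ge> 0" by simp
    thus "(\<Sum>s\<in>{S<..N}. 1 / (real s)\<^sup>2) \<le> 1 / real S"
      using sum_inverse_squares_tail[OF S True] by linarith
  qed simp
  finally show ?thesis by simp
qed

section \<open>An approximate clock\<close>

text \<open>With \<open>s\<close> the root of \<open>r\<close> of order \<open>Suc d\<close>, the
  expression is the \<open>Suc d\<close>-th power of \<open>(4 * k + 1) * s ^ k\<close>.\<close>

lemma polynomial_times_geometric_tendsto_0:
  fixes r :: real
  assumes "0 < r" "r < 1"
  shows "(\<lambda>k. real (4 * k + 1) ^ Suc d * r ^ k) \<longlonglongrightarrow> 0"
proof -
  define s where "s = root (Suc d) r"
  have s: "0 < s" "s < 1" "s ^ Suc d = r"
    using assms by (simp_all add: s_def del: power_Suc)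
  have "(\<lambda>k. 4 * (real k * s ^ k) + s ^ k) \<longlonglongrightarrow> 4 * 0 + 0"
    using s powser_times_n_limit_0[of s] by (intro tendsto_intros LIMSEQ_power_zero) auto
  hence "(\<lambda>k. (4 * (real k * s ^ k) + s ^ k) ^ Suc d) \<longlonglongrightarrow> 0 ^ Suc d"
    by (intro tendsto_power) simp
  also have "(\<lambda>k. (4 * (real k * s ^ k) + s ^ k) ^ Suc d) = (\<lambda>k. real (4 * k + 1) ^ Suc d * r ^ k)"
  proof
    fix k
    have "(4 * (real k * s ^ k) + s ^ k) ^ Suc d = (real (4 * k + 1) * s ^ k) ^ Suc d"
      by (simp add: algebra_simps del: power_Suc)
    also have "\<dots> = real (4 * k + 1) ^ Suc d * (s ^ k) ^ Suc d"
      by (rule power_mult_distrib)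
    also have "(s ^ k) ^ Suc d = r ^ k"
      by (metis s(3) power_mult mult.commute)
    finally show "(4 * (real k * s ^ k) + s ^ k) ^ Suc d = real (4 * k + 1) ^ Suc d * r ^ k" .
  qed
  finally show ?thesis by simp
qed

text \<open>The boxes \<open>P R\<close> grow polynomially, so \<open>card (P (2 * k))\<close> cannot increase by a fixed factor at every step.\<close>

lemma nested_Folner_sets:
  fixes \<Theta> :: "real set"
  assumes fin: "finite \<Theta>" and \<epsilon>: "\<epsilon> > 0"
  obtains C W W' where "finite W'" "W' \<noteq> {}" "C \<subseteq> W" "W \<subseteq> W'"
    and "\<And>\<tau> \<theta>. \<tau> \<in> C \<Longrightarrow> \<theta> \<in> \<Theta> \<Longrightarrow> \<tau> - \<theta> \<in> W"
    and "\<And>\<tau> \<theta>. \<tau> \<in> W \<Longrightarrow> \<theta> \<in> \<Theta> \<Longrightarrow> \<tau> + \<theta> \<in> W'"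
    and "real (card (W' - C)) \<le> \<epsilon> * real (card W')"
proof -
  define S where "S c = (\<Sum>\<theta>\<in>\<Theta>. of_int (c \<theta>) * \<theta>)" for c :: "real \<Rightarrow> int"
  \<comment> \<open>Integer combinations of \<open>\<Theta>\<close> with coefficients bounded by
    \<open>R\<close>; a shift by an element of \<open>\<Theta>\<close> raises the bound by
    one.\<close>
  define P where "P R = S ` (\<Theta> \<rightarrow>\<^sub>E {- int R..int R})" for R
  have fin_PiE: "finite (\<Theta> \<rightarrow>\<^sub>E {- int R..int R})" for R
    using fin by (intro finite_PiE) auto
  have finP: "finite (P R)" for R
    using fin_PiE by (simp add: P_def)
  have neP: "P R \<noteq> {}" for R
    by (auto simp: P_def PiE_eq_empty_iff)
  have monoP: "P R \<subseteq> P (Suc R)" for R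
    unfolding P_def by (intro image_mono PiE_mono) auto
  have shiftP: "\<tau> + of_int e * \<theta> \<in> P (Suc R)" if step: "\<tau> \<in> P R" "\<theta> \<in> \<Theta>" "e \<in> {-1, 1}" for \<tau> \<theta> e R
  proof -
    obtain c where c: "c \<in> \<Theta> \<rightarrow>\<^sub>E {- int R..int R}" "\<tau> = S c"
      using step(1) unfolding P_def by blast
    let ?c = "c(\<theta> := c \<theta> + e)"
    have "S ?c = of_int (c \<theta> + e) * \<theta> + (\<Sum>x\<in>\<Theta> - {\<theta>}. of_int (c x) * x)"
      unfolding S_def using fin step by (subst sum.remove[of _ \<theta>]) auto
    also have "\<dots> = S c + of_int e * \<theta>"
      unfolding S_def using fin step by (subst sum.remove[of _ \<theta> "\<lambda>x. of_int (c x) * x"]) (auto simp: algebra_simps)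
    finally have "\<tau> + of_int e * \<theta> = S ?c" using c by simp
    moreover have "?c \<in> \<Theta> \<rightarrow>\<^sub>E {- int (Suc R)..int (Suc R)}"
    proof (rule PiE_I)
      fix x assume "x \<in> \<Theta>"
      hence "c x \<in> {- int R..int R}" using c by auto
      thus "?c x \<in> {- int (Suc R)..int (Suc R)}" using step(3) by auto
    next
      fix x assume "x \<notin> \<Theta>"
      thus "?c x = undefined" using PiE_arb[OF c(1), of x] step(2) by (cases "x = \<theta>") simp_all
    qed
    ultimately show ?thesis by (simp add: P_def)
  qed
  have cardP: "card (P R) \<le> (2 * R + 1) ^ card \<Theta>" for R
  proof -
    have "card (P R) \<le> card (\<Theta> \<rightarrow>\<^sub>E {- int R..int R})"
      unfolding P_def by (rule card_image_le[OF fin_PiE])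
    also have "\<dots> = (2 * R + 1) ^ card \<Theta>"
    proof -
      have "card {- int R..int R} = 2 * R + 1" by simp
      thus ?thesis using fin by (simp add: card_PiE)
    qed
    finally show ?thesis .
  qed
  \<comment> \<open>Steps of two, because \<open>C\<close>, \<open>W\<close>, \<open>W'\<close> will
    be three consecutive boxes.\<close>
  define p where "p k = real (card (P (2 * k)))" for k
  have p1: "p k \<ge> 1" for k
    using finP neP by (simp add: p_def Suc_le_eq card_gt_0_iff)
  have "\<exists>k. (1 - \<epsilon>) * p (Suc k) \<le> p k"
  proof (cases "\<epsilon> < 1")
    case False
    hence "(1 - \<epsilon>) * p (Suc 0) \<le> 0" using p1[of 1] by (simp add: mult_nonpos_nonneg)
    also have "0 \<le> p 0" using p1[of 0] by simp
    finally show ?thesis by blast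
  next
    case True
    define r where "r = 1 - \<epsilon>"
    have r: "0 < r" "r < 1" using True \<epsilon> by (auto simp: r_def)
    show ?thesis
    proof (rule ccontr)
      assume "\<not> ?thesis"
      hence less: "p k \<le> r * p (Suc k)" for k by (simp add: r_def not_le less_imp_le)
      have ge1: "1 \<le> p k * r ^ k" for k
      proof (induction k)
        case 0
        show ?case using p1[of 0] by simp
      next
        case (Suc k)
        have "p k * r ^ k \<le> r * p (Suc k) * r ^ k"
          using less r by (intro mult_right_mono) auto
        thus ?case using Suc by (simp add: algebra_simps)
      qed
      have "1 \<le> real (4 * k + 1) ^ Suc (card \<Theta>) * r ^ k" for k
      proof -
        have "p k \<le> real (4 * k + 1) ^ card \<Theta>"
        proof -
          have "card (P (2 * k)) \<le> (4 * k + 1) ^ card \<Theta>" using cardP[of "2 * k"] by simp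
          thus ?thesis unfolding p_def of_nat_power[symmetric] by (rule of_nat_mono)
        qed
        also have "\<dots> \<le> real (4 * k + 1) ^ Suc (card \<Theta>)"
          by (intro power_increasing) auto
        finally have "p k * r ^ k \<le> real (4 * k + 1) ^ Suc (card \<Theta>) * r ^ k"
          using r by (intro mult_right_mono) auto
        thus ?thesis using ge1[of k] by linarith
      qed
      hence "(1 :: real) \<le> 0"
        by (intro LIMSEQ_le_const[OF polynomial_times_geometric_tendsto_0[OF r]]) blast
      thus False by simp
    qed
  qed
  then obtain k where k: "(1 - \<epsilon>) * p (Suc k) \<le> p k" ..
  have sub: "P (2 * k) \<subseteq> P (2 * Suc k)"
    using monoP[of "2 * k"] monoP[of "Suc (2 * k)"] by simp
  show thesis
  proof (rule that[of "P (2 * Suc k)" "P (2 * k)" "P (Suc (2 * k))"])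
    show "finite (P (2 * Suc k))" "P (2 * Suc k) \<noteq> {}" by (fact finP neP)+
    show "P (2 * k) \<subseteq> P (Suc (2 * k))" "P (Suc (2 * k)) \<subseteq> P (2 * Suc k)"
      using monoP[of "2 * k"] monoP[of "Suc (2 * k)"] by simp_all
    show "\<tau> - \<theta> \<in> P (Suc (2 * k))" if "\<tau> \<in> P (2 * k)" "\<theta> \<in> \<Theta>" for \<tau> \<theta>
      using shiftP[OF that, of "-1"] by simp
    show "\<tau> + \<theta> \<in> P (2 * Suc k)" if "\<tau> \<in> P (Suc (2 * k))" "\<theta> \<in> \<Theta>" for \<tau> \<theta>
      using shiftP[OF that, of 1] by simp
    have "real (card (P (2 * Suc k) - P (2 * k))) = p (Suc k) - p k"
      unfolding p_def using sub finP by (simp add: card_Diff_subset card_mono of_nat_diff)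
    also have "\<dots> \<le> \<epsilon> * p (Suc k)"
      using k by (simp add: algebra_simps)
    finally show "real (card (P (2 * Suc k) - P (2 * k))) \<le> \<epsilon> * real (card (P (2 * Suc k)))"
      by (simp add: p_def)
  qed
qed

text \<open>Under a uniformly random permutation every index is equally likely to carry the largest value.\<close>

lemma card_permutes_argmax_le:
  fixes A :: "nat set" and a :: "'i \<Rightarrow> nat"
  assumes fin: "finite A" "finite I" and inj: "inj_on a I" and sub: "a ` I \<subseteq> A" and J: "J \<subseteq> I"
  shows "card {\<sigma>. \<sigma> permutes A \<and> (\<exists>\<tau>\<in>J. \<forall>t\<in>I. \<sigma> (a t) \<le> \<sigma> (a \<tau>))} * card I
    \<le> card J * card {\<sigma>. \<sigma> permutes A}"
proof (cases "I = {}")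
  case True
  thus ?thesis using J by simp
next
  case False
  define Q where "Q \<tau> = {\<sigma>. \<sigma> permutes A \<and> (\<forall>t\<in>I. \<sigma> (a t) \<le> \<sigma> (a \<tau>))}" for \<tau>
  have finQ: "finite (Q \<tau>)" for \<tau>
    using finite_permutations[OF fin(1)] by (rule finite_subset[rotated]) (auto simp: Q_def)
  have cardQ: "card (Q \<tau>) \<le> card (Q \<tau>')" if \<tau>: "\<tau> \<in> I" "\<tau>' \<in> I" for \<tau> \<tau>'
  proof (rule card_inj_on_le[OF _ _ finQ])
    \<comment> \<open>Precomposition with this transposition exchanges the ranks of the two indices,
      so each is the winner equally often.\<close>
    let ?s = "Transposition.transpose (a \<tau>) (a \<tau>')"
    show "inj_on (\<lambda>\<sigma>. \<sigma> \<circ> ?s) (Q \<tau>)"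
      by (rule inj_on_inverseI[of _ "\<lambda>\<sigma>. \<sigma> \<circ> ?s"]) (simp add: comp_assoc)
    show "(\<lambda>\<sigma>. \<sigma> \<circ> ?s) ` Q \<tau> \<subseteq> Q \<tau>'"
    proof safe
      fix \<sigma> assume \<sigma>: "\<sigma> \<in> Q \<tau>"
      have "?s permutes A" using \<tau> sub by (intro permutes_swap_id) auto
      moreover have "\<sigma> (?s (a t)) \<le> \<sigma> (?s (a \<tau>'))" if "t \<in> I" for t
        using \<sigma> \<tau> that by (auto simp: Q_def Transposition.transpose_def)
      ultimately show "\<sigma> \<circ> ?s \<in> Q \<tau>'"
        using \<sigma> by (auto simp: Q_def permutes_compose)
    qed
  qed
  obtain \<tau>0 where \<tau>0: "\<tau>0 \<in> I" using False by auto
  have eqQ: "card (Q \<tau>) = card (Q \<tau>0)" if "\<tau> \<in> I" for \<tau>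
    using cardQ[OF that \<tau>0] cardQ[OF \<tau>0 that] by simp
  have disj: "Q \<tau> \<inter> Q \<tau>' = {}" if "\<tau> \<in> I" "\<tau>' \<in> I" "\<tau> \<noteq> \<tau>'" for \<tau> \<tau>'
  proof (rule ccontr)
    assume "Q \<tau> \<inter> Q \<tau>' \<noteq> {}"
    then obtain \<sigma> where "\<sigma> \<in> Q \<tau>" "\<sigma> \<in> Q \<tau>'" by blast
    hence \<sigma>: "\<sigma> permutes A" "\<sigma> (a \<tau>) = \<sigma> (a \<tau>')"
      using that by (auto simp: Q_def intro: antisym)
    hence "a \<tau> = a \<tau>'" by (metis permutes_inverses(2))
    thus False using inj that by (auto dest: inj_onD)
  qed
  have "card I * card (Q \<tau>0) = (\<Sum>\<tau>\<in>I. card (Q \<tau>))"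
    using eqQ by simp
  also have "\<dots> = card (\<Union>\<tau>\<in>I. Q \<tau>)"
    using fin finQ disj by (intro card_UN_disjoint[symmetric]) auto
  also have "\<dots> \<le> card {\<sigma>. \<sigma> permutes A}"
    using finite_permutations[OF fin(1)] by (intro card_mono) (auto simp: Q_def)
  finally have le: "card I * card (Q \<tau>0) \<le> card {\<sigma>. \<sigma> permutes A}" .
  have "card {\<sigma>. \<sigma> permutes A \<and> (\<exists>\<tau>\<in>J. \<forall>t\<in>I. \<sigma> (a t) \<le> \<sigma> (a \<tau>))} = card (\<Union>\<tau>\<in>J. Q \<tau>)"
    by (rule arg_cong[of _ _ card]) (auto simp: Q_def)
  also have "\<dots> \<le> (\<Sum>\<tau>\<in>J. card (Q \<tau>))"
    using J fin by (intro card_UN_le finite_subset[of J I])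
  also have "\<dots> = card J * card (Q \<tau>0)"
    using eqQ J by (simp add: subset_iff)
  finally have "card {\<sigma>. \<sigma> permutes A \<and> (\<exists>\<tau>\<in>J. \<forall>t\<in>I. \<sigma> (a t) \<le> \<sigma> (a \<tau>))} * card I
      \<le> card J * card (Q \<tau>0) * card I"
    by (rule mult_right_mono) simp
  also have "\<dots> = card J * (card I * card (Q \<tau>0))" by simp
  also have "\<dots> \<le> card J * card {\<sigma>. \<sigma> permutes A}"
    using le by (rule mult_left_mono) simp
  finally show ?thesis .
qed

section \<open>A separating coordinate on the space and its behaviour along orbits\<close>

context lebesgue_prob_space
begin

lemma measurable_injection:
  obtains \<xi> :: "'a \<Rightarrow> real" and X where "\<xi> \<in> borel_measurable M" "\<And>x. 0 \<le> \<xi> x \<and> \<xi> x \<le> 1"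
    and "X \<in> sets M" "space M - X \<in> null_sets M" "inj_on \<xi> X"
proof -
  obtain B where B: "B \<in> sets (lebesgue :: real measure)" "B \<subseteq> {0..1}"
    and iso: "measure_isomorphic M (restrict_space lebesgue B)"
    using isomorphic_unit_interval by blast
  let ?N = "restrict_space lebesgue B :: real measure"
  from iso obtain X Y and f :: "'a \<Rightarrow> real" and g where X: "X \<in> sets M" "space M - X \<in> null_sets M"
    and Y: "Y \<in> sets ?N" and f: "f \<in> restrict_space M X \<rightarrow>\<^sub>M restrict_space ?N Y"
    and g: "\<forall>x\<in>X. g (f x) = x"
    unfolding measure_isomorphic_def by blast
  have fB: "f x \<in> B" if "x \<in> X" for x
    using measurable_space[OF f, of x] that sets.sets_into_space[OF X(1)]
    by (auto simp: space_restrict_space)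
  have "(\<lambda>y. y) \<in> (lebesgue :: real measure) \<rightarrow>\<^sub>M borel"
    by (simp add: measurable_completion)
  hence "(\<lambda>y. y) \<in> restrict_space ?N Y \<rightarrow>\<^sub>M borel"
    by (intro measurable_restrict_space1)
  from measurable_compose[OF f this] have "f \<in> restrict_space M X \<rightarrow>\<^sub>M borel" by simp
  \<comment> \<open>Outside the conull set \<open>X\<close> the default \<open>0\<close> keeps the
    coordinate in the unit interval.\<close>
  hence "(\<lambda>x. if x \<in> X then f x else 0) \<in> borel_measurable M"
    using X(1) by (subst measurable_restrict_space_iff[symmetric]) auto
  moreover have "inj_on (\<lambda>x. if x \<in> X then f x else 0) X"
    by (rule inj_on_inverseI[of _ g]) (use g in auto)
  moreover have "0 \<le> (if x \<in> X then f x else 0) \<and> (if x \<in> X then f x else 0) \<le> 1" for x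
    using fB[of x] B(2) by auto
  ultimately show thesis using X that by blast
qed

end

text \<open>The dyadic cells of level \<open>k\<close> separate two points as soon as
  \<open>2 ^ k\<close> times their distance exceeds \<open>1\<close>.\<close>

lemma eventually_floor_neq:
  fixes y z :: real
  assumes "y \<noteq> z" "0 \<le> y" "0 \<le> z"
  shows "eventually (\<lambda>k. nat \<lfloor>2 ^ k * y\<rfloor> \<noteq> nat \<lfloor>2 ^ k * z\<rfloor>) sequentially"
proof -
  have "0 < \<bar>y - z\<bar>" using assms by simp
  then obtain k0 where k0: "1 / \<bar>y - z\<bar> < 2 ^ k0"
    using real_arch_pow[of 2 "1 / \<bar>y - z\<bar>"] by auto
  show ?thesis
  proof (rule eventually_sequentiallyI[of k0])
    fix k assume "k0 \<le> k"
    hence "(2 :: real) ^ k0 \<le> 2 ^ k" by (intro power_increasing) auto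
    hence "1 / \<bar>y - z\<bar> < 2 ^ k" using k0 by linarith
    hence "1 < 2 ^ k * \<bar>y - z\<bar>"
      using \<open>0 < \<bar>y - z\<bar>\<close> by (simp add: field_simps)
    also have "\<dots> = \<bar>2 ^ k * y - 2 ^ k * z\<bar>"
      by (simp add: abs_mult flip: right_diff_distrib)
    finally have "1 < \<bar>2 ^ k * y - 2 ^ k * z\<bar>" .
    hence "\<lfloor>2 ^ k * y\<rfloor> \<noteq> \<lfloor>2 ^ k * z\<rfloor>" by linarith
    thus "nat \<lfloor>2 ^ k * y\<rfloor> \<noteq> nat \<lfloor>2 ^ k * z\<rfloor>"
      using assms by (simp add: nat_eq_iff)
  qed
qed

context measure_preserving_flow
begin

lemma AE_preserved:
  assumes "AE x in M. P x"
  shows "AE x in M. P (T t x)"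
proof -
  from assms obtain N where N: "N \<in> null_sets M" "{x \<in> space M. \<not> P x} \<subseteq> N"
    unfolding eventually_ae_filter by blast
  have "T t -` N \<inter> space M \<in> null_sets M"
    using N measure_preserving[of N t] measurable_sets[OF measurable_time]
    by (auto simp: null_sets_def)
  moreover have "{x \<in> space M. \<not> P (T t x)} \<subseteq> T t -` N \<inter> space M"
    using N(2) measurable_space[OF measurable_time] by auto
  ultimately show ?thesis by (rule AE_I')
qed

end

context aperiodic_dynamical_system
begin

text \<open>Aperiodicity makes the points \<open>T t x\<close> distinct for almost every
  \<open>x\<close>, and almost surely all of these finitely many points lie in the set where
  \<open>\<xi>\<close> is injective.\<close>

lemma AE_inj_on_orbit:
  assumes X: "space M - X \<in> null_sets M" and inj: "inj_on \<xi> X" and fin: "finite I"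
  shows "AE x in M. inj_on (\<lambda>t. \<xi> (T t x)) I"
proof -
  have "AE x in M. x \<in> X"
    by (rule AE_I'[OF X]) auto
  hence "AE x in M. \<forall>t\<in>I. T t x \<in> X"
    using fin by (intro AE_finite_allI AE_preserved)
  moreover have "AE x in M. \<not> (\<exists>t s. t \<noteq> s \<and> T t x = T s x)"
    by (rule AE_I'[OF aperiodic]) auto
  ultimately show ?thesis
  proof eventually_elim
    case (elim x)
    show ?case
    proof (rule inj_onI)
      fix t s assume "t \<in> I" "s \<in> I" "\<xi> (T t x) = \<xi> (T s x)"
      hence "T t x = T s x" using elim(1) by (intro inj_onD[OF inj]) auto
      thus "t = s" using elim(2) by blast
    qed
  qed
qed

text \<open>The clock reads off the position, in a large Folner window of the orbit, of the point whose atom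
  in a fine partition has the largest rank for a random ordering of the atoms.\<close>

lemma approximate_clock:
  assumes \<Theta>: "finite \<Theta>" and \<eta>: "\<eta> > 0"
  obtains \<phi> :: "'a \<Rightarrow> real" where "simple_function M \<phi>"
    and "{x \<in> space M. \<exists>\<theta>\<in>\<Theta>. \<phi> (T \<theta> x) \<noteq> \<phi> x + \<theta>} \<in> sets M"
    and "measure M {x \<in> space M. \<exists>\<theta>\<in>\<Theta>. \<phi> (T \<theta> x) \<noteq> \<phi> x + \<theta>} < \<eta>"
proof -
  \<comment> \<open>One half of the error is for windows that the partition fails to separate, the
    other for maxima outside the core \<open>C\<close>.\<close>
  have "\<eta> / 2 > 0" using \<eta> by simp
  from nested_Folner_sets[OF \<Theta> this] obtain C W W' where W': "finite W'" "W' \<noteq> {}"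
    and sub: "C \<subseteq> W" "W \<subseteq> W'"
    and minus: "\<And>\<tau> \<theta>. \<tau> \<in> C \<Longrightarrow> \<theta> \<in> \<Theta> \<Longrightarrow> \<tau> - \<theta> \<in> W"
    and plus: "\<And>\<tau> \<theta>. \<tau> \<in> W \<Longrightarrow> \<theta> \<in> \<Theta> \<Longrightarrow> \<tau> + \<theta> \<in> W'"
    and card: "real (card (W' - C)) \<le> \<eta> / 2 * real (card W')"
    by metis
  have finW: "finite W" using sub W' finite_subset by auto
  obtain \<xi> :: "'a \<Rightarrow> real" and X where \<xi>: "\<xi> \<in> borel_measurable M" "\<And>x. 0 \<le> \<xi> x \<and> \<xi> x \<le> 1"
    and X: "X \<in> sets M" "space M - X \<in> null_sets M" "inj_on \<xi> X"
    using measurable_injection by blast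
  note [measurable] = \<xi>(1) measurable_time
  define atom where "atom k t x = nat \<lfloor>2 ^ k * \<xi> (T t x)\<rfloor>" for k :: nat and t x
  have atom_measurable [measurable]: "atom k t \<in> M \<rightarrow>\<^sub>M count_space UNIV" for k t
    unfolding atom_def by measurable
  have nat_eq_sets: "{x \<in> space M. u x = v x} \<in> sets M"
    if [measurable]: "u \<in> M \<rightarrow>\<^sub>M count_space UNIV" "v \<in> M \<rightarrow>\<^sub>M count_space UNIV" for u v :: "'a \<Rightarrow> nat"
    using borel_measurable_eq[of "\<lambda>x. real (u x)" M "\<lambda>x. real (v x)"] by simp
  have atom_le: "atom k t x \<le> 2 ^ k" for k t x
  proof -
    have "2 ^ k * \<xi> (T t x) \<le> 2 ^ k" using \<xi>(2)[of "T t x"] by simp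
    hence "2 ^ k * \<xi> (T t x) < of_int (2 ^ k) + 1" unfolding of_int_power of_int_numeral by linarith
    hence "\<lfloor>2 ^ k * \<xi> (T t x)\<rfloor> \<le> 2 ^ k" by (simp only: floor_le_iff)
    thus ?thesis by (simp add: atom_def nat_le_iff)
  qed
  \<comment> \<open>Points with two times of the window in the same atom. Almost every point leaves
    \<open>Bad k\<close> for large \<open>k\<close>, so its measure tends to
    \<open>0\<close>.\<close>
  define Bad where "Bad k = {x \<in> space M. \<exists>t\<in>W'. \<exists>s\<in>W'. t \<noteq> s \<and> atom k t x = atom k s x}" for k
  have Bad_sets: "Bad k \<in> sets M" for k
    unfolding Bad_def
    by (intro sets.sets_Collect_finite_Ex sets.sets_Collect_conj sets.sets_Collect_const W'
        nat_eq_sets atom_measurable)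
  have "(\<lambda>k. \<integral>x. indicator (Bad k) x \<partial>M) \<longlonglongrightarrow> (\<integral>x. (0::real) \<partial>M)"
  proof (rule integral_dominated_convergence[where w = "\<lambda>_. 1"])
    show "AE x in M. (\<lambda>k. indicator (Bad k) x :: real) \<longlonglongrightarrow> 0"
      using AE_inj_on_orbit[OF X(2,3) W'(1)]
    proof eventually_elim
      case (elim x)
      have "eventually (\<lambda>k. \<forall>t\<in>W'. \<forall>s\<in>W'. t \<noteq> s \<longrightarrow> atom k t x \<noteq> atom k s x) sequentially"
      proof (intro eventually_ball_finite W' ballI)
        fix t s assume "t \<in> W'" "s \<in> W'"
        show "eventually (\<lambda>k. t \<noteq> s \<longrightarrow> atom k t x \<noteq> atom k s x) sequentially"
        proof (cases "t = s")
          case False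
          hence "\<xi> (T t x) \<noteq> \<xi> (T s x)" using elim \<open>t \<in> W'\<close> \<open>s \<in> W'\<close> by (auto dest: inj_onD)
          from eventually_floor_neq[OF this] show ?thesis
            using \<xi>(2) by (auto simp: atom_def elim: eventually_mono)
        qed simp
      qed
      hence "eventually (\<lambda>k. indicator (Bad k) x = (0 :: real)) sequentially"
        by eventually_elim (auto simp: Bad_def indicator_def)
      thus ?case by (rule tendsto_eventually)
    qed
  qed (use Bad_sets in \<open>auto split: split_indicator\<close>)
  hence "(\<lambda>k. measure M (Bad k)) \<longlonglongrightarrow> 0"
    using Bad_sets by simp
  from order_tendstoD(2)[OF this \<open>\<eta> / 2 > 0\<close>] obtain k where k: "measure M (Bad k) < \<eta> / 2"
    by (auto simp: eventually_sequentially)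
  \<comment> \<open>The index \<open>2 ^ k\<close> is included because \<open>\<xi>\<close> may take
    the value \<open>1\<close>.\<close>
  define A where "A = {..(2 :: nat) ^ k}"
  define S where "S = {\<sigma>. \<sigma> permutes A}"
  have "id \<in> S" "finite S" by (simp_all add: S_def A_def permutes_id finite_permutations)
  hence finS: "finite S" "S \<noteq> {}" by auto
  define a where "a = atom k"
  have a_shift: "a t (T \<theta> x) = a (t + \<theta>) x" if "x \<in> space M" for t \<theta> x
    using that add_time by (simp add: a_def atom_def)
  have [measurable]: "a t \<in> M \<rightarrow>\<^sub>M count_space UNIV" for t
    by (simp add: a_def)
  have real_a [measurable]: "(\<lambda>x. real (\<sigma> (a t x))) \<in> borel_measurable M" for \<sigma> :: "nat \<Rightarrow> nat" and t
    by (rule measurable_compose[of "a t" M "count_space UNIV"]) simp_all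
  have less_sets: "{x \<in> space M. \<sigma> (a t x) < \<sigma> (a s x)} \<in> sets M"
    and le_sets: "{x \<in> space M. \<sigma> (a t x) \<le> \<sigma> (a s x)} \<in> sets M" for \<sigma> :: "nat \<Rightarrow> nat" and t s
    using borel_measurable_less[OF real_a real_a] borel_measurable_le[OF real_a real_a] by simp_all
  define leader where "leader \<sigma> x = {\<tau>\<in>W. \<forall>t\<in>W. t \<noteq> \<tau> \<longrightarrow> \<sigma> (a t x) < \<sigma> (a \<tau> x)}" for \<sigma> :: "nat \<Rightarrow> nat" and x
  have leader_eq: "leader \<sigma> y = {w}" if w: "w \<in> W" "\<And>t. t \<in> W \<Longrightarrow> t \<noteq> w \<Longrightarrow> \<sigma> (a t y) < \<sigma> (a w y)"
    for \<sigma> y w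
  proof -
    have "w \<in> leader \<sigma> y" using w by (simp add: leader_def)
    moreover have "u = w" if u: "u \<in> leader \<sigma> y" for u
    proof (rule ccontr)
      assume "u \<noteq> w"
      hence "\<sigma> (a w y) < \<sigma> (a u y)" "\<sigma> (a u y) < \<sigma> (a w y)"
        using u w by (auto simp: leader_def)
      thus False by simp
    qed
    ultimately show ?thesis by blast
  qed
  \<comment> \<open>The strict inequality allows at most one leader; the sum extracts it and is
    \<open>0\<close> if there is none. The sign is negative because a leader \<open>\<tau>\<close>
    of \<open>x\<close> becomes the leader \<open>\<tau> - \<theta>\<close> of
    \<open>T \<theta> x\<close>.\<close>
  define \<Lambda> where "\<Lambda> \<sigma> x = - \<Sum> (leader \<sigma> x)" for \<sigma> x
  have \<Lambda>_simple: "simple_function M (\<Lambda> \<sigma>)" for \<sigma>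
  proof (rule simple_function_borel_measurable)
    have "\<Lambda> \<sigma> = (\<lambda>x. - (\<Sum>\<tau>\<in>W. if \<forall>t\<in>W. t \<noteq> \<tau> \<longrightarrow> \<sigma> (a t x) < \<sigma> (a \<tau> x) then \<tau> else 0))"
      by (rule ext) (simp add: \<Lambda>_def leader_def sum.inter_filter[OF finW])
    also have "\<dots> \<in> borel_measurable M"
      by (intro borel_measurable_uminus borel_measurable_sum measurable_If measurable_const
          sets.sets_Collect_finite_All sets.sets_Collect_imp sets.sets_Collect_const finW less_sets)
        simp_all
    finally show "\<Lambda> \<sigma> \<in> borel_measurable M" .
    have "\<Lambda> \<sigma> ` space M \<subseteq> (\<lambda>F. - \<Sum> F) ` Pow W"
      by (auto simp: \<Lambda>_def leader_def)
    thus "finite (\<Lambda> \<sigma> ` space M)"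
      using finW by (meson finite_Pow_iff finite_imageI finite_subset)
  qed
  have [measurable]: "\<Lambda> \<sigma> \<in> borel_measurable M" for \<sigma>
    by (rule borel_measurable_simple_function[OF \<Lambda>_simple])
  define Err where "Err \<sigma> = {x \<in> space M. \<exists>\<theta>\<in>\<Theta>. \<Lambda> \<sigma> (T \<theta> x) \<noteq> \<Lambda> \<sigma> x + \<theta>}" for \<sigma>
  have Err_sets [measurable]: "Err \<sigma> \<in> sets M" for \<sigma>
    unfolding Err_def
  proof (intro sets.sets_Collect_finite_Ex \<Theta>)
    fix \<theta>
    show "{x \<in> space M. \<Lambda> \<sigma> (T \<theta> x) \<noteq> \<Lambda> \<sigma> x + \<theta>} \<in> sets M" by measurable
  qed
  define G where "G \<sigma> = {x \<in> space M. x \<notin> Bad k \<and> (\<exists>\<tau>\<in>W' - C. \<forall>t\<in>W'. \<sigma> (a t x) \<le> \<sigma> (a \<tau> x))}"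
    for \<sigma> :: "nat \<Rightarrow> nat"
  have G_sets: "G \<sigma> \<in> sets M" for \<sigma>
    unfolding G_def using W' Bad_sets
    by (intro sets.sets_Collect_conj sets.sets_Collect_finite_Ex sets.sets_Collect_finite_All le_sets)
      (auto simp: set_diff_eq[symmetric])
  have Err_sub: "Err \<sigma> \<subseteq> Bad k \<union> G \<sigma>" if \<sigma>: "\<sigma> \<in> S" for \<sigma>
  proof
    fix x assume x: "x \<in> Err \<sigma>"
    hence xM: "x \<in> space M" by (simp add: Err_def)
    show "x \<in> Bad k \<union> G \<sigma>"
    proof (rule ccontr)
      assume neg: "x \<notin> Bad k \<union> G \<sigma>"
      have "Max ((\<lambda>t. \<sigma> (a t x)) ` W') \<in> (\<lambda>t. \<sigma> (a t x)) ` W'"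
        using W' by (intro Max_in) auto
      then obtain \<tau> where "\<tau> \<in> W'" "Max ((\<lambda>t. \<sigma> (a t x)) ` W') = \<sigma> (a \<tau> x)" by auto
      hence \<tau>: "\<tau> \<in> W'" "\<And>t. t \<in> W' \<Longrightarrow> \<sigma> (a t x) \<le> \<sigma> (a \<tau> x)"
        using Max_ge[of "(\<lambda>t. \<sigma> (a t x)) ` W'"] W' by auto
      have \<tau>C: "\<tau> \<in> C" using neg \<tau> xM by (auto simp: G_def)
      have less: "\<sigma> (a t x) < \<sigma> (a \<tau> x)" if "t \<in> W'" "t \<noteq> \<tau>" for t
      proof -
        have "a t x \<noteq> a \<tau> x" using neg xM that \<tau> by (auto simp: Bad_def a_def)
        hence "\<sigma> (a t x) \<noteq> \<sigma> (a \<tau> x)"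
          using \<sigma> by (metis S_def mem_Collect_eq permutes_inverses(2))
        thus ?thesis using \<tau>(2)[OF that(1)] by simp
      qed
      have "leader \<sigma> x = {\<tau>}"
        using less sub \<tau>C by (intro leader_eq) auto
      hence 1: "\<Lambda> \<sigma> x = - \<tau>" by (simp add: \<Lambda>_def)
      \<comment> \<open>Seen from \<open>T \<theta> x\<close>, the window \<open>W\<close> is the
        translate of \<open>W\<close> by \<open>\<theta>\<close>. It stays inside \<open>W'\<close>,
        where \<open>\<tau>\<close> is the strict winner, and contains \<open>\<tau>\<close> because
        \<open>\<tau>\<close> is in \<open>C\<close>.\<close>
      have "\<Lambda> \<sigma> (T \<theta> x) = \<Lambda> \<sigma> x + \<theta>" if \<theta>: "\<theta> \<in> \<Theta>" for \<theta>
      proof -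
        have m: "\<tau> - \<theta> \<in> W" using minus \<tau>C \<theta> by simp
        have "leader \<sigma> (T \<theta> x) = {\<tau> - \<theta>}"
        proof -
          have "\<sigma> (a t (T \<theta> x)) < \<sigma> (a (\<tau> - \<theta>) (T \<theta> x))" if "t \<in> W" "t \<noteq> \<tau> - \<theta>" for t
            using less[of "t + \<theta>"] plus[OF that(1) \<theta>] that(2) by (auto simp: a_shift[OF xM])
          thus ?thesis using m by (intro leader_eq)
        qed
        thus ?thesis by (simp add: \<Lambda>_def 1[unfolded \<Lambda>_def])
      qed
      thus False using x by (auto simp: Err_def)
    qed
  qed
  \<comment> \<open>First-moment argument: for each fixed \<open>x\<close> few orderings are bad by
    \<open>card_permutes_argmax_le\<close>, so integrating over \<open>x\<close> leaves some
    ordering that is bad only on a small set.\<close>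
  have "(\<Sum>\<sigma>\<in>S. measure M (G \<sigma>)) = (\<integral>x. (\<Sum>\<sigma>\<in>S. indicator (G \<sigma>) x) \<partial>M)"
    using G_sets by (simp add: integral_sum emeasure_eq_measure)
  also have "\<dots> \<le> (\<integral>x. \<eta> / 2 * real (card S) \<partial>M)"
  proof (rule integral_mono)
    show "integrable M (\<lambda>x. \<Sum>\<sigma>\<in>S. indicator (G \<sigma>) x :: real)"
      using G_sets by (intro Bochner_Integration.integrable_sum) (simp add: emeasure_eq_measure)
    fix x assume xM: "x \<in> space M"
    show "(\<Sum>\<sigma>\<in>S. indicator (G \<sigma>) x) \<le> \<eta> / 2 * real (card S)"
    proof (cases "x \<in> Bad k")
      case True
      thus ?thesis using \<eta> by (simp add: G_def)
    next
      case False
      define J where "J = {\<sigma>. \<sigma> permutes A \<and> (\<exists>\<tau>\<in>W' - C. \<forall>t\<in>W'. \<sigma> (a t x) \<le> \<sigma> (a \<tau> x))}"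
      have "inj_on (\<lambda>t. a t x) W'"
        using False xM by (auto simp: Bad_def a_def inj_on_def)
      hence "card J * card W' \<le> card (W' - C) * card S"
        unfolding J_def S_def using W'
        by (intro card_permutes_argmax_le) (auto simp: A_def a_def atom_le)
      hence "real (card J) * real (card W') \<le> real (card (W' - C)) * real (card S)"
        by (simp flip: of_nat_mult)
      also have "\<dots> \<le> (\<eta> / 2 * real (card W')) * real (card S)"
        using card by (rule mult_right_mono) simp
      finally have "real (card J) * real (card W') \<le> (\<eta> / 2 * real (card S)) * real (card W')"
        by (simp add: algebra_simps)
      hence "real (card J) \<le> \<eta> / 2 * real (card S)"
        using W' by (simp add: card_gt_0_iff)
      moreover have "(\<Sum>\<sigma>\<in>S. indicator (G \<sigma>) x) = real (card J)"
      proof -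
        have "(\<Sum>\<sigma>\<in>S. indicator (G \<sigma>) x :: real) = (\<Sum>\<sigma>\<in>S. indicator J \<sigma>)"
          using xM False by (intro sum.cong) (auto simp: G_def J_def S_def indicator_def)
        also have "\<dots> = (\<Sum>\<sigma>\<in>S \<inter> J. 1)"
          unfolding sum.inter_restrict[OF finS(1)] by (intro sum.cong) (auto simp: indicator_def)
        also have "\<dots> = real (card (S \<inter> J))" by simp
        also have "S \<inter> J = J" by (auto simp: J_def S_def)
        finally show ?thesis .
      qed
      ultimately show ?thesis by simp
    qed
  qed simp
  also have "\<dots> = \<eta> / 2 * real (card S)"
    by (simp add: prob_space)
  finally have sum_le: "(\<Sum>\<sigma>\<in>S. measure M (G \<sigma>)) \<le> \<eta> / 2 * real (card S)" .
  have "\<exists>\<sigma>\<in>S. measure M (G \<sigma>) \<le> \<eta> / 2"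
  proof (rule ccontr)
    assume "\<not> ?thesis"
    hence "(\<Sum>\<sigma>\<in>S. \<eta> / 2) < (\<Sum>\<sigma>\<in>S. measure M (G \<sigma>))"
      using finS by (intro sum_strict_mono) auto
    thus False using sum_le by (simp add: mult.commute)
  qed
  then obtain \<sigma> where \<sigma>: "\<sigma> \<in> S" "measure M (G \<sigma>) \<le> \<eta> / 2" by blast
  have "measure M (Err \<sigma>) \<le> measure M (Bad k \<union> G \<sigma>)"
    using Err_sub[OF \<sigma>(1)] Bad_sets G_sets by (intro finite_measure_mono) auto
  also have "\<dots> \<le> measure M (Bad k) + measure M (G \<sigma>)"
    using Bad_sets G_sets by (intro measure_Un_le) auto
  also have "\<dots> < \<eta>" using k \<sigma> by simp
  finally show thesis
    using that[OF \<Lambda>_simple[of \<sigma>]] Err_sets[of \<sigma>] by (simp add: Err_def)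
qed

end

section \<open>Sweeping out\<close>

lemma additive_extension_image:
  fixes f :: "nat \<Rightarrow> real" and p :: "nat \<Rightarrow> real"
  assumes "rat_real.independent (p ` D)" and inj: "inj_on p D"
  obtains g :: "real \<Rightarrow> real" where "\<And>x y. g (x + y) = g x + g y" and "\<And>n. n \<in> D \<Longrightarrow> g (p n) = f n"
proof -
  obtain g :: "real \<Rightarrow> real" where "\<And>x y. g (x + y) = g x + g y"
    "\<And>x. x \<in> p ` D \<Longrightarrow> g x = f (inv_into D p x)"
    using additive_extension[OF assms(1), of "\<lambda>x. f (inv_into D p x)"] by auto
  thus thesis using inj by (intro that[of g]) auto
qed

section \<open>Averages along the powers and a single sweeping set\<close>

definition power_average :: "(real \<Rightarrow> 'a \<Rightarrow> 'a) \<Rightarrow> real \<Rightarrow> 'a set \<Rightarrow> nat \<Rightarrow> 'a \<Rightarrow> real" where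
  "power_average T \<alpha> E N x = 1 / real N * (\<Sum>n=1..N. indicator E (T (real n powr \<alpha>) x))"

lemma power_average_bounds: "0 \<le> power_average T \<alpha> E N x" "power_average T \<alpha> E N x \<le> 1"
proof -
  show "0 \<le> power_average T \<alpha> E N x"
    by (simp add: power_average_def sum_nonneg)
  have "(\<Sum>n=1..N. indicator E (T (real n powr \<alpha>) x) :: real) \<le> (\<Sum>n=1..N. 1)"
    by (intro sum_mono) (simp add: indicator_def)
  thus "power_average T \<alpha> E N x \<le> 1"
    by (cases "N = 0") (simp_all add: power_average_def field_simps)
qed

lemma (in flow) power_average_measurable [measurable]:
  "E \<in> sets M \<Longrightarrow> power_average T \<alpha> E N \<in> borel_measurable M"
  unfolding power_average_def
  by (intro borel_measurable_times borel_measurable_const borel_measurable_sum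
      measurable_compose[OF measurable_time borel_measurable_indicator])

text \<open>Pigeonhole: \<open>K\<close> disjoint fibres have total measure at most
  \<open>1\<close>.\<close>

lemma (in prob_space) exists_small_fibre:
  fixes f :: "'a \<Rightarrow> int"
  assumes f: "simple_function M f" and K: "K > 0"
  obtains c where "c \<in> {0..<int K}" "measure M {x \<in> space M. f x = c} \<le> 1 / real K"
proof -
  have sets: "{x \<in> space M. f x = c} \<in> sets M" for c
    using simple_functionD(2)[OF f, of "{c}"] by (simp add: vimage_def Int_def conj_commute)
  have "(\<Sum>c\<in>{0..<int K}. measure M {x \<in> space M. f x = c}) = measure M (\<Union>c\<in>{0..<int K}. {x \<in> space M. f x = c})"
    using sets by (intro finite_measure_finite_Union[symmetric]) (auto simp: disjoint_family_on_def)
  also have "\<dots> \<le> 1" by simp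
  finally have le: "(\<Sum>c\<in>{0..<int K}. measure M {x \<in> space M. f x = c}) \<le> 1" .
  show thesis
  proof (rule ccontr)
    assume "\<not> thesis"
    hence "\<not> measure M {x \<in> space M. f x = c} \<le> 1 / real K" if "c \<in> {0..<int K}" for c
      using that \<open>\<And>c. c \<in> {0..<int K} \<Longrightarrow> measure M {x \<in> space M. f x = c} \<le> 1 / real K \<Longrightarrow> thesis\<close> by blast
    hence "(\<Sum>c\<in>{0..<int K}. 1 / real K) < (\<Sum>c\<in>{0..<int K}. measure M {x \<in> space M. f x = c})"
      using K by (intro sum_strict_mono) (auto simp: not_le)
    thus False using le K by simp
  qed
qed

text \<open>The grid: the blocks \<open>(N0 * S^i, N0 * S^(i+1)]\<close> run through all shift vectors in \<open>[K]^S\<close>, one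
  coordinate for each of the first \<open>S\<close> strata.  Whatever the vector of colours of \<open>x\<close> is, one block
  shifts all of its coordinates to the colours that define \<open>E\<close>.\<close>

lemma (in aperiodic_dynamical_system) sweeping_set:
  fixes a b N0 :: nat
  assumes ab: "coprime a b" "a > 0" "b \<ge> 2" and \<eta>: "\<eta> > 0" and N0: "N0 > 0"
  obtains E N1 where "E \<in> sets M" "measure M E < \<eta>"
    and "measure M {x \<in> space M. \<forall>N\<in>{N0..N1}. power_average T (real a / real b) E N x \<le> 1 - \<eta>} < \<eta>"
proof -
  define \<alpha> where "\<alpha> = real a / real b"
  have \<alpha>: "\<alpha> > 0" using ab by (simp add: \<alpha>_def)
  \<comment> \<open>A proportion \<open>1 / S\<close> is lost to higher strata and another
    \<open>1 / S\<close> to integers before the block, whence \<open>2 / S < \<eta>\<close>. With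
    \<open>K = S^2\<close>, the \<open>S\<close> fibres of measure at most \<open>1 / K\<close>
    together have measure at most \<open>1 / S\<close>.\<close>
  define S where "S = nat \<lceil>2 / \<eta>\<rceil> + 2"
  define K where "K = S ^ 2"
  have S2: "S \<ge> 2" by (simp add: S_def)
  have K0: "K > 0" using S2 by (simp add: K_def)
  have "2 / \<eta> < real S" unfolding S_def by linarith
  hence S\<eta>: "2 / real S < \<eta>" using \<eta> S2 by (simp add: field_simps)
  define V where "V = {1..S} \<rightarrow>\<^sub>E {..<K}"
  have finV: "finite V" by (simp add: V_def finite_PiE)
  obtain h where h: "bij_betw h {0..<card V} V"
    using ex_bij_betw_nat_finite[OF finV] by blast
  define idx where "idx n = (LEAST i. n \<le> N0 * S ^ Suc i)" for n
  have idx: "idx n = i" if "N0 * S ^ i < n" "n \<le> N0 * S ^ Suc i" for n i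
    unfolding idx_def
  proof (rule Least_equality)
    fix j assume j: "n \<le> N0 * S ^ Suc j"
    show "i \<le> j"
    proof (rule ccontr)
      assume "\<not> i \<le> j"
      hence "S ^ Suc j \<le> S ^ i" using S2 by (intro power_increasing) auto
      hence "N0 * S ^ Suc j \<le> N0 * S ^ i" by (rule mult_left_mono) simp
      thus False using j that(1) by (meson le_trans not_le)
    qed
  qed (fact that)
  \<comment> \<open>The prescribed values are multiples of \<open>1 / K\<close>, so after scaling by
    \<open>K\<close> the shift is an integer and passes through the floor in the colour
    \<open>f\<close>.\<close>
  have "\<exists>g :: real \<Rightarrow> real. (\<forall>x y. g (x + y) = g x + g y) \<and>
      (\<forall>n\<in>stratum b s. g (real n powr \<alpha>) = real (h (idx n) s) / real K)" if "s \<in> {1..S}" for s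
  proof -
    have "inj_on (\<lambda>n. real n powr \<alpha>) (stratum b s)"
    proof (rule inj_onI)
      fix m n :: nat assume "real m powr \<alpha> = real n powr \<alpha>"
      hence "(real m powr \<alpha>) powr (1 / \<alpha>) = (real n powr \<alpha>) powr (1 / \<alpha>)" by simp
      thus "m = n" using \<alpha> by (simp add: powr_powr)
    qed
    moreover have "rat_real.independent ((\<lambda>n. real n powr \<alpha>) ` stratum b s)"
      unfolding \<alpha>_def using ab that by (intro independent_stratum_powers) auto
    ultimately show ?thesis
      using additive_extension_image[of "\<lambda>n. real n powr \<alpha>" "stratum b s" "\<lambda>n. real (h (idx n) s) / real K"]
      by metis
  qed
  then obtain g :: "nat \<Rightarrow> real \<Rightarrow> real" where add: "\<And>s x y. s \<in> {1..S} \<Longrightarrow> g s (x + y) = g s x + g s y"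
    and g: "\<And>s n. s \<in> {1..S} \<Longrightarrow> n \<in> stratum b s \<Longrightarrow> g s (real n powr \<alpha>) = real (h (idx n) s) / real K"
    by metis
  define N1 where "N1 = N0 * S ^ card V"
  define \<Theta> where "\<Theta> = (\<lambda>n. real n powr \<alpha>) ` {1..N1}"
  have "finite \<Theta>" by (simp add: \<Theta>_def)
  then obtain \<phi> :: "'a \<Rightarrow> real" where \<phi>: "simple_function M \<phi>"
    and err_sets: "{x \<in> space M. \<exists>\<theta>\<in>\<Theta>. \<phi> (T \<theta> x) \<noteq> \<phi> x + \<theta>} \<in> sets M"
    and err: "measure M {x \<in> space M. \<exists>\<theta>\<in>\<Theta>. \<phi> (T \<theta> x) \<noteq> \<phi> x + \<theta>} < \<eta>"
    by (rule approximate_clock[OF _ \<eta>])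
  define f where "f s x = \<lfloor>real K * g s (\<phi> x)\<rfloor> mod int K" for s x
  \<comment> \<open>The composition is simple for an arbitrary additive \<open>g s\<close>, since
    \<open>\<phi>\<close> takes only finitely many values.\<close>
  have f_simple: "simple_function M (f s)" for s
    unfolding f_def using simple_function_compose[OF \<phi>, of "\<lambda>y. \<lfloor>real K * g s y\<rfloor> mod int K"]
    by (simp add: comp_def)
  have "\<exists>c\<in>{0..<int K}. measure M {x \<in> space M. f s x = c} \<le> 1 / real K" for s
    using exists_small_fibre[OF f_simple K0] by metis
  then obtain c where c_range: "\<And>s. c s \<in> {0..<int K}"
    and c: "\<And>s. measure M {x \<in> space M. f s x = c s} \<le> 1 / real K" by metis
  have fibre_sets: "{x \<in> space M. f s x = d} \<in> sets M" for s d
    using simple_functionD(2)[OF f_simple, of s "{d}"] by (simp add: vimage_def Int_def conj_commute)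
  define E where "E = (\<Union>s\<in>{1..S}. {x \<in> space M. f s x = c s})"
  have E_sets: "E \<in> sets M" unfolding E_def using fibre_sets by blast
  have "measure M E \<le> (\<Sum>s\<in>{1..S}. measure M {x \<in> space M. f s x = c s})"
    unfolding E_def using fibre_sets by (intro measure_UNION_le) auto
  also have "\<dots> \<le> (\<Sum>s\<in>{1..S}. 1 / real K)"
    by (intro sum_mono c)
  also have "\<dots> = 1 / real S"
    using S2 by (simp add: K_def power2_eq_square)
  also have "\<dots> < \<eta>"
    using S\<eta> S2 by (simp add: field_simps)
  finally have E_small: "measure M E < \<eta>" .
  have good: "\<exists>N\<in>{N0..N1}. 1 - \<eta> < power_average T \<alpha> E N x"
    if x: "x \<in> space M" and clock: "\<forall>\<theta>\<in>\<Theta>. \<phi> (T \<theta> x) = \<phi> x + \<theta>" for x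
  proof -
    \<comment> \<open>The shift that carries every colour of \<open>x\<close> to the chosen
      \<open>c s\<close>; the block \<open>i\<close> with \<open>h i = v\<close> realises
      it.\<close>
    define v where "v = (\<lambda>s\<in>{1..S}. nat ((c s - f s x) mod int K))"
    have "v \<in> V"
      using K0 by (auto simp: v_def V_def nat_less_iff)
    hence "v \<in> h ` {0..<card V}" using h by (simp add: bij_betw_def)
    then obtain i where i: "i < card V" "h i = v" by auto
    define N where "N = N0 * S ^ Suc i"
    have N: "N = S * (N0 * S ^ i)" by (simp add: N_def)
    have N_le: "N0 \<le> N" "N \<le> N1"
      using i S2 power_increasing[of "Suc i" "card V" S] by (auto simp: N_def N1_def simp del: power_Suc)
    have hit: "T (real n powr \<alpha>) x \<in> E" if n: "N0 * S ^ i < n" "n \<le> N" and s: "s \<in> {1..S}" "n \<in> stratum b s" for n s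
    proof -
      have "real n powr \<alpha> \<in> \<Theta>" using n N_le by (auto simp: \<Theta>_def)
      hence "\<phi> (T (real n powr \<alpha>) x) = \<phi> x + real n powr \<alpha>" using clock by simp
      hence "real K * g s (\<phi> (T (real n powr \<alpha>) x)) = real K * g s (\<phi> x) + of_int (int (v s))"
        using K0 s add g idx[of i n] n i by (simp add: N_def distrib_left)
      hence "f s (T (real n powr \<alpha>) x) = (\<lfloor>real K * g s (\<phi> x)\<rfloor> + int (v s)) mod int K"
        unfolding f_def by (simp only: floor_add_int)
      also have "int (v s) = (c s - f s x) mod int K"
        using s K0 by (simp add: v_def)
      also have "(\<lfloor>real K * g s (\<phi> x)\<rfloor> + (c s - f s x) mod int K) mod int K = c s mod int K"
        by (simp add: f_def mod_simps)
      also have "\<dots> = c s" using c_range[of s] by simp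
      finally have "f s (T (real n powr \<alpha>) x) = c s" .
      thus ?thesis
        using s measurable_space[OF measurable_time x] by (auto simp: E_def)
    qed
    let ?G = "{n\<in>{1..N}. N0 * S ^ i < n \<and> (\<exists>s\<in>{1..S}. n \<in> stratum b s)}"
    let ?B = "{n\<in>{1..N}. \<forall>s\<in>{1..S}. n \<notin> stratum b s}"
    \<comment> \<open>Three kinds of integers: those in block \<open>i\<close> and in one of the
      first \<open>S\<close> strata, all of which hit \<open>E\<close>; those before the block;
      those outside the strata.\<close>
    have "{1..N} \<subseteq> ?G \<union> {1..N0 * S ^ i} \<union> ?B" by auto
    hence "card {1..N} \<le> card (?G \<union> {1..N0 * S ^ i} \<union> ?B)" by (intro card_mono) auto
    also have "\<dots> \<le> card ?G + card {1..N0 * S ^ i} + card ?B"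
      using card_Un_le[of "?G \<union> {1..N0 * S ^ i}" ?B] card_Un_le[of ?G "{1..N0 * S ^ i}"] by linarith
    finally have "N \<le> card ?G + N0 * S ^ i + card ?B" by simp
    hence "real N \<le> real (card ?G + N0 * S ^ i + card ?B)" by (rule of_nat_mono)
    hence "real N \<le> real (card ?G) + real (N0 * S ^ i) + real (card ?B)"
      by (simp only: of_nat_add)
    moreover have "real (N0 * S ^ i) = real N / real S"
      using S2 by (simp add: N)
    moreover have "real (card ?B) \<le> real N / real S"
      using ab S2 by (intro card_not_in_strata_le) auto
    ultimately have G_ge: "real N * (1 - 2 / real S) \<le> real (card ?G)"
      by (simp add: algebra_simps)
    have "real (card ?G) = (\<Sum>n\<in>?G. 1)" by simp
    also have "\<dots> \<le> (\<Sum>n\<in>?G. indicator E (T (real n powr \<alpha>) x))"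
      using hit by (intro sum_mono) auto
    also have "\<dots> \<le> (\<Sum>n=1..N. indicator E (T (real n powr \<alpha>) x))"
      by (intro sum_mono2) auto
    finally have "real N * (1 - 2 / real S) \<le> (\<Sum>n=1..N. indicator E (T (real n powr \<alpha>) x))"
      using G_ge by simp
    moreover have "real N > 0" using N_le N0 by simp
    ultimately have "1 - 2 / real S \<le> power_average T \<alpha> E N x"
      by (simp add: power_average_def field_simps)
    thus ?thesis using S\<eta> N_le by (intro bexI[of _ N]) auto
  qed
  have "measure M {x \<in> space M. \<forall>N\<in>{N0..N1}. power_average T \<alpha> E N x \<le> 1 - \<eta>} < \<eta>"
  proof (rule le_less_trans[OF finite_measure_mono[OF _ err_sets] err])
    show "{x \<in> space M. \<forall>N\<in>{N0..N1}. power_average T \<alpha> E N x \<le> 1 - \<eta>}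
        \<subseteq> {x \<in> space M. \<exists>\<theta>\<in>\<Theta>. \<phi> (T \<theta> x) \<noteq> \<phi> x + \<theta>}"
      using good by (auto simp: not_less[symmetric])
  qed
  thus thesis
    using that E_sets E_small by (simp add: \<alpha>_def)
qed

section \<open>Oscillating averages from a sequence of sweeping sets\<close>

lemma limsup_ereal_eq_1I:
  fixes u :: "nat \<Rightarrow> real"
  assumes le: "\<And>n. u n \<le> 1" and ex: "\<And>e m. e > 0 \<Longrightarrow> \<exists>n\<ge>m. 1 - e < u n"
  shows "limsup (\<lambda>n. ereal (u n)) = 1"
proof (rule antisym)
  show "limsup (\<lambda>n. ereal (u n)) \<le> 1"
    using le by (intro Limsup_bounded) simp
  show "1 \<le> limsup (\<lambda>n. ereal (u n))"
    unfolding limsup_INF_SUP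
  proof (intro INF_greatest, unfold le_SUP_iff, intro allI impI)
    fix m and y :: ereal assume y: "y < 1"
    then obtain r where r: "y < ereal r" "ereal r < 1" using ereal_dense2 by blast
    hence "1 - r > 0" by (simp add: one_ereal_def)
    then obtain n where "n \<ge> m" "r < u n" using ex[of "1 - r" m] by auto
    thus "\<exists>n\<in>{m..}. y < ereal (u n)"
      using r(1) by (intro bexI[of _ n] less_trans[of y "ereal r" "ereal (u n)"]) auto
  qed
qed

lemma liminf_ereal_eq_0I:
  fixes u :: "nat \<Rightarrow> real"
  assumes ge: "\<And>n. 0 \<le> u n" and ex: "\<And>e m. e > 0 \<Longrightarrow> \<exists>n\<ge>m. u n < e"
  shows "liminf (\<lambda>n. ereal (u n)) = 0"
proof (rule antisym)
  show "0 \<le> liminf (\<lambda>n. ereal (u n))"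
    using ge by (intro Liminf_bounded) simp
  show "liminf (\<lambda>n. ereal (u n)) \<le> 0"
    unfolding liminf_SUP_INF
  proof (intro SUP_least, unfold INF_le_iff, intro allI impI)
    fix m and y :: ereal assume y: "0 < y"
    then obtain r where r: "0 < ereal r" "ereal r < y" using ereal_dense2 by blast
    then obtain n where "n \<ge> m" "u n < r" using ex[of r m] by auto
    thus "\<exists>n\<in>{m..}. ereal (u n) < y"
      using r(2) by (intro bexI[of _ n] less_trans[of "ereal (u n)" "ereal r" y]) auto
  qed
qed

lemma power_average_mono:
  assumes "\<And>n. n \<in> {1..N} \<Longrightarrow> T (real n powr \<alpha>) x \<in> E \<Longrightarrow> T (real n powr \<alpha>) x \<in> F"
  shows "power_average T \<alpha> E N x \<le> power_average T \<alpha> F N x"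
  unfolding power_average_def using assms
  by (intro mult_left_mono sum_mono) (auto simp: indicator_def)

lemma power_average_disjoint:
  assumes "\<And>n. n \<in> {1..N} \<Longrightarrow> T (real n powr \<alpha>) x \<in> E \<Longrightarrow> T (real n powr \<alpha>) x \<notin> F"
  shows "power_average T \<alpha> F N x \<le> 1 - power_average T \<alpha> E N x"
proof -
  have "power_average T \<alpha> F N x \<le> power_average T \<alpha> (- E) N x"
    using assms by (intro power_average_mono) auto
  also have "power_average T \<alpha> (- E) N x + power_average T \<alpha> E N x \<le> 1"
  proof -
    have "power_average T \<alpha> (- E) N x + power_average T \<alpha> E N x = power_average T \<alpha> UNIV N x"
      unfolding power_average_def distrib_left[symmetric] sum.distrib[symmetric]
      by (intro arg_cong2[of _ _ _ _ "(*)"] sum.cong refl) (simp add: indicator_def)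
    thus ?thesis using power_average_bounds(2) by metis
  qed
  ultimately show ?thesis by linarith
qed

text \<open>A point of \<open>E\<close> is one whose last visit to the sequence \<open>A\<close> has an even index.  Along the first
  \<open>L j\<close> times a typical orbit meets no \<open>A i\<close> with \<open>i > j\<close>, so there \<open>E\<close> contains \<open>A j\<close> for even \<open>j\<close>
  and is disjoint from it for odd \<open>j\<close>.\<close>

lemma (in aperiodic_dynamical_system) strong_sweeping_out:
  fixes a b :: nat
  assumes ab: "coprime a b" "a > 0" "b \<ge> 2" and \<epsilon>: "\<epsilon> > 0"
  obtains E where "E \<in> sets M" "measure M E < \<epsilon>"
    and "AE x in M. limsup (\<lambda>N. ereal (power_average T (real a / real b) E N x)) = 1"
    and "AE x in M. liminf (\<lambda>N. ereal (power_average T (real a / real b) E N x)) = 0"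
proof -
  let ?avg = "power_average T (real a / real b)"
  \<comment> \<open>The total is \<open>min 1 \<epsilon> / 2\<close>, which is below
    \<open>\<epsilon>\<close>; summability serves Borel-Cantelli.\<close>
  define \<delta> where "\<delta> j = min 1 \<epsilon> / 4 * (1 / 2) ^ j" for j :: nat
  have \<delta>_pos: "\<delta> j > 0" for j using \<epsilon> by (simp add: \<delta>_def)
  have \<delta>_summable: "summable \<delta>"
    unfolding \<delta>_def by (intro summable_mult summable_geometric) simp
  have \<delta>_sum: "suminf \<delta> < \<epsilon>"
  proof -
    have "suminf \<delta> = min 1 \<epsilon> / 4 * (\<Sum>j. (1 / 2) ^ j)"
      unfolding \<delta>_def by (intro suminf_mult summable_geometric) simp
    also have "\<dots> = min 1 \<epsilon> / 2" by (simp add: suminf_geometric)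
    also have "\<dots> < \<epsilon>" using \<epsilon> by (simp add: min_def)
    finally show ?thesis .
  qed
  \<comment> \<open>Starting at \<open>Suc j\<close> forces the times of large average to tend to
    infinity with \<open>j\<close>.\<close>
  define P where "P j = (\<lambda>(F, L :: nat). F \<in> sets M \<and> measure M F < \<delta> j \<and>
    measure M {x \<in> space M. \<forall>N\<in>{Suc j..L}. ?avg F N x \<le> 1 - \<delta> j} < \<delta> j)" for j
  \<comment> \<open>The next set is so small that, by a union bound, few orbits meet it within the
    first \<open>L\<close> times.\<close>
  define Q where "Q j = (\<lambda>(F :: 'a set, L :: nat) (F', L' :: nat). L \<le> L' \<and> real L * measure M F' < \<delta> (Suc j))" for j
  have step: "\<exists>y. P j y \<and> (case y of (F', L') \<Rightarrow> L \<le> L' \<and> real L * measure M F' < \<delta> j)" for j L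
  proof -
    \<comment> \<open>Dividing by \<open>Suc L\<close> makes \<open>L * \<eta>\<close> smaller than
      \<open>\<delta> j\<close>, and stays meaningful for \<open>L = 0\<close>.\<close>
    define \<eta> where "\<eta> = \<delta> j / real (Suc L)"
    have \<eta>: "\<eta> > 0" "\<eta> \<le> \<delta> j" "real L * \<eta> \<le> \<delta> j"
      using \<delta>_pos[of j] by (auto simp: \<eta>_def field_simps)
    from sweeping_set[OF ab \<eta>(1), of "Suc j"] obtain F N1 where F: "F \<in> sets M" "measure M F < \<eta>"
      "measure M {x \<in> space M. \<forall>N\<in>{Suc j..N1}. ?avg F N x \<le> 1 - \<eta>} < \<eta>"
      by auto
    have "measure M {x \<in> space M. \<forall>N\<in>{Suc j..max L N1}. ?avg F N x \<le> 1 - \<delta> j} \<le>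
        measure M {x \<in> space M. \<forall>N\<in>{Suc j..N1}. ?avg F N x \<le> 1 - \<eta>}"
    proof (rule finite_measure_mono)
      show "{x \<in> space M. \<forall>N\<in>{Suc j..max L N1}. ?avg F N x \<le> 1 - \<delta> j} \<subseteq>
          {x \<in> space M. \<forall>N\<in>{Suc j..N1}. ?avg F N x \<le> 1 - \<eta>}"
      proof safe
        fix x N assume "\<forall>N\<in>{Suc j..max L N1}. ?avg F N x \<le> 1 - \<delta> j" "N \<in> {Suc j..N1}"
        hence "?avg F N x \<le> 1 - \<delta> j" by auto
        thus "?avg F N x \<le> 1 - \<eta>" using \<eta>(2) by linarith
      qed
      show "{x \<in> space M. \<forall>N\<in>{Suc j..N1}. ?avg F N x \<le> 1 - \<eta>} \<in> sets M"
        using F(1) by (intro sets.sets_Collect_finite_All borel_measurable_le power_average_measurable) auto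
    qed
    moreover have "real L * measure M F \<le> real L * \<eta>"
      using F(2) by (intro mult_left_mono) auto
    moreover have "real L * \<eta> < \<delta> j"
      using \<delta>_pos[of j] by (simp add: \<eta>_def field_simps)
    ultimately have "P j (F, max L N1) \<and> L \<le> max L N1 \<and> real L * measure M F < \<delta> j"
      using F \<eta> by (auto simp: P_def)
    thus ?thesis by (intro exI[of _ "(F, max L N1)"]) simp
  qed
  have "\<exists>f. \<forall>n. P n (f n) \<and> Q n (f n) (f (Suc n))"
  proof (rule dependent_nat_choice)
    show "\<exists>y. P 0 y" using step[of 0 0] by blast
    fix y n assume "P n y"
    show "\<exists>z. P (Suc n) z \<and> Q n y z"
      using step[of "Suc n" "snd y"] by (auto simp: Q_def case_prod_beta)
  qed
  then obtain f where f: "\<And>n. P n (f n)" "\<And>n. Q n (f n) (f (Suc n))" by blast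
  define A where "A n = fst (f n)" for n
  define L where "L n = snd (f n)" for n
  have A_sets [measurable]: "A j \<in> sets M" and A_small: "measure M (A j) < \<delta> j"
    and A_avg: "measure M {x \<in> space M. \<forall>N\<in>{Suc j..L j}. ?avg (A j) N x \<le> 1 - \<delta> j} < \<delta> j"
    and L_step: "L j \<le> L (Suc j)" "real (L j) * measure M (A (Suc j)) < \<delta> (Suc j)" for j
    using f(1)[of j] f(2)[of j] by (auto simp: P_def Q_def A_def L_def case_prod_beta)
  have L_mono: "L i \<le> L j" if "i \<le> j" for i j
    using that L_step(1) by (rule lift_Suc_mono_le[rotated])
  \<comment> \<open>On \<open>B1 j\<close> the averages of \<open>A j\<close> stay low up to time
    \<open>L j\<close>; on \<open>B2 j\<close> the orbit meets \<open>A (Suc j)\<close> during the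
    first \<open>L j\<close> times. Both sequences have summable measure, so almost every point lies
    in only finitely many of these sets.\<close>
  define B1 where "B1 j = {x \<in> space M. \<forall>N\<in>{Suc j..L j}. ?avg (A j) N x \<le> 1 - \<delta> j}" for j
  define B2 where "B2 j = (\<Union>n\<in>{1..L j}. T (real n powr (real a / real b)) -` A (Suc j) \<inter> space M)" for j
  have B1_sets: "B1 j \<in> sets M" for j
    unfolding B1_def
    by (intro sets.sets_Collect_finite_All borel_measurable_le power_average_measurable A_sets) auto
  have pre_sets: "T t -` A i \<inter> space M \<in> sets M" for t i
    using measurable_sets[OF measurable_time A_sets] .
  have B2_sets: "B2 j \<in> sets M" for j
    unfolding B2_def using pre_sets by blast
  have B2_small: "measure M (B2 j) < \<delta> (Suc j)" for j
  proof -
    have "measure M (B2 j) \<le> (\<Sum>n\<in>{1..L j}. measure M (T (real n powr (real a / real b)) -` A (Suc j) \<inter> space M))"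
      unfolding B2_def using pre_sets by (intro measure_UNION_le) auto
    also have "\<dots> = (\<Sum>n\<in>{1..L j}. measure M (A (Suc j)))"
      using measure_preserving[OF A_sets] by (simp add: measure_def)
    also have "\<dots> = real (L j) * measure M (A (Suc j))" by simp
    finally show ?thesis using L_step(2)[of j] by linarith
  qed
  have "AE x in M. eventually (\<lambda>j. x \<in> space M - B1 j) sequentially"
  proof (rule borel_cantelli_AE1[OF B1_sets])
    show "summable (\<lambda>j. measure M (B1 j))"
      using A_avg by (intro summable_comparison_test'[OF \<delta>_summable, of 0]) (auto simp: B1_def less_imp_le)
  qed (simp add: emeasure_eq_measure)
  moreover have "AE x in M. eventually (\<lambda>j. x \<in> space M - B2 j) sequentially"
  proof (rule borel_cantelli_AE1[OF B2_sets])
    have "summable (\<lambda>j. \<delta> (Suc j))"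
      using \<delta>_summable by (simp only: summable_Suc_iff)
    thus "summable (\<lambda>j. measure M (B2 j))"
      by (rule summable_comparison_test'[where N = 0]) (simp add: less_imp_le[OF B2_small])
  qed (simp add: emeasure_eq_measure)
  ultimately have AE_good: "AE x in M. x \<in> space M \<and> (\<exists>J. \<forall>j\<ge>J. x \<notin> B1 j \<and> x \<notin> B2 j)"
    using AE_space
  proof eventually_elim
    case (elim x)
    from eventually_conj[OF elim(1,2)] show ?case
      using elim(3) by (auto simp: eventually_sequentially)
  qed
  define E where "E = (\<Union>j\<in>{j. even j}. A j - (\<Union>i\<in>{j<..}. A i))"
  have E_sets: "E \<in> sets M"
    unfolding E_def by (intro sets.countable_UN'' sets.Diff) auto
  have E_small: "measure M E < \<epsilon>"
  proof -
    have sm: "summable (\<lambda>j. measure M (A j))"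
      using A_small by (intro summable_comparison_test'[OF \<delta>_summable, of 0]) (auto simp: less_imp_le)
    have "measure M E \<le> measure M (\<Union>j. A j)"
      by (intro finite_measure_mono) (auto simp: E_def)
    also have "\<dots> \<le> (\<Sum>j. measure M (A j))"
      using sm by (intro finite_measure_subadditive_countably) auto
    also have "\<dots> \<le> suminf \<delta>"
      using A_small sm \<delta>_summable by (intro suminf_le) (auto simp: less_imp_le)
    finally show ?thesis using \<delta>_sum by linarith
  qed
  have orbit: "\<exists>J. \<forall>j\<ge>J. \<exists>N\<ge>j. (even j \<longrightarrow> 1 - \<delta> j < ?avg E N x) \<and> (odd j \<longrightarrow> ?avg E N x < \<delta> j)"
    if x: "x \<in> space M" and J: "\<forall>j\<ge>J. x \<notin> B1 j \<and> x \<notin> B2 j" for x J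
  proof (rule exI[of _ J], intro allI impI)
    fix j assume j: "J \<le> j"
    hence "x \<notin> B1 j" using J by blast
    then obtain N where N: "N \<in> {Suc j..L j}" "1 - \<delta> j < ?avg (A j) N x"
      using x by (auto simp: B1_def not_le)
    \<comment> \<open>Apply the choice of \<open>x\<close> outside \<open>B2\<close> at the index
      before \<open>i\<close>; its time range contains \<open>{1..N}\<close> because
      \<open>L\<close> is monotone.\<close>
    have avoid: "T (real n powr (real a / real b)) x \<notin> A i" if n: "n \<in> {1..N}" and i: "j < i" for n i
    proof -
      obtain i' where i': "i = Suc i'" "j \<le> i'" using i by (cases i) auto
      have "n \<in> {1..L i'}" using n N L_mono[OF i'(2)] by auto
      moreover have "x \<notin> B2 i'" using J i' j by auto
      ultimately show ?thesis using x i' by (auto simp: B2_def)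
    qed
    have "1 - \<delta> j < ?avg E N x" if "even j"
    proof -
      have "?avg (A j) N x \<le> ?avg E N x"
        using avoid that by (intro power_average_mono) (auto simp: E_def)
      thus ?thesis using N by simp
    qed
    moreover have "?avg E N x < \<delta> j" if "odd j"
    proof -
      \<comment> \<open>Membership in \<open>E\<close> would give an even last index
        \<open>k\<close>. It cannot be below \<open>j\<close>, since \<open>A j\<close> is hit, nor
        above \<open>j\<close> by \<open>avoid\<close>, nor equal to the odd
        \<open>j\<close>.\<close>
      have "T (real n powr (real a / real b)) x \<notin> E"
        if n: "n \<in> {1..N}" and hit: "T (real n powr (real a / real b)) x \<in> A j" for n
      proof
        assume "T (real n powr (real a / real b)) x \<in> E"
        then obtain k where k: "even k" "T (real n powr (real a / real b)) x \<in> A k"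
          "\<And>i. k < i \<Longrightarrow> T (real n powr (real a / real b)) x \<notin> A i"
          by (auto simp: E_def)
        have "\<not> j < k" using avoid[OF n] k(2) by blast
        moreover have "\<not> k < j" using k(3) hit by blast
        moreover have "k \<noteq> j" using k(1) \<open>odd j\<close> by blast
        ultimately show False by simp
      qed
      hence "?avg E N x \<le> 1 - ?avg (A j) N x"
        by (intro power_average_disjoint)
      thus ?thesis using N by simp
    qed
    ultimately show "\<exists>N\<ge>j. (even j \<longrightarrow> 1 - \<delta> j < ?avg E N x) \<and> (odd j \<longrightarrow> ?avg E N x < \<delta> j)"
      using N by (intro exI[of _ N]) auto
  qed
  have \<delta>_tendsto: "\<delta> \<longlonglongrightarrow> 0" by (rule summable_LIMSEQ_zero[OF \<delta>_summable])
  have large: "\<exists>j\<ge>m. \<delta> j < e \<and> (even j \<longleftrightarrow> p)" if "e > 0" for e m p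
  proof -
    from order_tendstoD(2)[OF \<delta>_tendsto that] obtain j0 where j0: "\<And>j. j \<ge> j0 \<Longrightarrow> \<delta> j < e"
      by (auto simp: eventually_sequentially)
    show ?thesis
    proof (cases "even (max j0 m) \<longleftrightarrow> p")
      case True
      thus ?thesis using j0 by (intro exI[of _ "max j0 m"]) auto
    next
      case False
      thus ?thesis using j0 by (intro exI[of _ "Suc (max j0 m)"]) auto
    qed
  qed
  have lims: "limsup (\<lambda>N. ereal (?avg E N x)) = 1 \<and> liminf (\<lambda>N. ereal (?avg E N x)) = 0"
    if x: "x \<in> space M \<and> (\<exists>J. \<forall>j\<ge>J. x \<notin> B1 j \<and> x \<notin> B2 j)" for x
  proof -
    obtain J where J: "\<And>j. j \<ge> J \<Longrightarrow>
        \<exists>N\<ge>j. (even j \<longrightarrow> 1 - \<delta> j < ?avg E N x) \<and> (odd j \<longrightarrow> ?avg E N x < \<delta> j)"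
      using x orbit by blast
    show ?thesis
    proof
      show "limsup (\<lambda>N. ereal (?avg E N x)) = 1"
      proof (rule limsup_ereal_eq_1I)
        fix e :: real and m assume "e > 0"
        from large[OF this, of "max J m" True] obtain j where j: "j \<ge> max J m" "\<delta> j < e" "even j" by auto
        then obtain N where "N \<ge> j" "1 - \<delta> j < ?avg E N x" using J[of j] by auto
        thus "\<exists>N\<ge>m. 1 - e < ?avg E N x" using j by (intro exI[of _ N]) auto
      qed (rule power_average_bounds)
      show "liminf (\<lambda>N. ereal (?avg E N x)) = 0"
      proof (rule liminf_ereal_eq_0I)
        fix e :: real and m assume "e > 0"
        from large[OF this, of "max J m" False] obtain j where j: "j \<ge> max J m" "\<delta> j < e" "odd j" by auto
        then obtain N where "N \<ge> j" "?avg E N x < \<delta> j" using J[of j] by auto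
        thus "\<exists>N\<ge>m. ?avg E N x < e" using j by (intro exI[of _ N]) auto
      qed (rule power_average_bounds)
    qed
  qed
  show thesis
  proof (rule that[OF E_sets E_small])
    show "AE x in M. limsup (\<lambda>N. ereal (?avg E N x)) = 1"
      using AE_good by eventually_elim (use lims in blast)
    show "AE x in M. liminf (\<lambda>N. ereal (?avg E N x)) = 0"
      using AE_good by eventually_elim (use lims in blast)
  qed
qed

theorem theorem1p3:
  fixes \<alpha> :: real and M :: "'a measure" and T :: "real \<Rightarrow> 'a \<Rightarrow> 'a" and \<epsilon> :: real
  assumes "\<alpha> > 0" and "\<alpha> \<in> \<rat>" and "\<alpha> \<notin> \<int>"
    and "aperiodic_dynamical_system M T"
    and "\<epsilon> > 0"
  shows "\<exists>E\<in>sets M. measure M E < \<epsilon> \<and>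
    (AE x in M. limsup (\<lambda>N. ereal (1 / real N * (\<Sum>n=1..N. indicator E (T (real n powr \<alpha>) x)))) = 1) \<and>
    (AE x in M. liminf (\<lambda>N. ereal (1 / real N * (\<Sum>n=1..N. indicator E (T (real n powr \<alpha>) x)))) = 0)"
proof -
  interpret aperiodic_dynamical_system M T by fact
  obtain a b :: nat where b: "b \<noteq> 0" "\<bar>\<alpha>\<bar> = real a / real b" and ab: "coprime a b"
    using Rats_abs_nat_div_natE[OF assms(2)] by metis
  have \<alpha>: "\<alpha> = real a / real b" using b assms(1) by simp
  \<comment> \<open>Non-integrality of \<open>\<alpha>\<close> enters here: \<open>b \<ge> 2\<close>
    makes the higher strata sparse.\<close>
  have "b \<noteq> 1" using assms(3) \<alpha> by auto
  hence "b \<ge> 2" using b by simp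
  moreover have "a > 0" using \<alpha> assms(1) by (auto intro: gr0I)
  ultimately obtain E where "E \<in> sets M" "measure M E < \<epsilon>"
    "AE x in M. limsup (\<lambda>N. ereal (power_average T \<alpha> E N x)) = 1"
    "AE x in M. liminf (\<lambda>N. ereal (power_average T \<alpha> E N x)) = 0"
    using strong_sweeping_out[OF ab _ _ assms(5)] unfolding \<alpha> by metis
  thus ?thesis unfolding power_average_def by blast
qed

end
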